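(* Let $\theta$ be an aperiodic primitive block $\mathbb{Z}^d$-substitution on a finite alphabet $\mathcal{A}$ whose column number $c_\theta$ satisfies $1<c_\theta<|\mathcal{A}|$, and let $\mathcal{N}(\mathbb{X}_\theta)$ be the extended symmetry group of the corresponding shift space $\mathbb{X}_\theta$. Then there is an algorithm which computes (from $\theta$) the elements of $\mathcal{N}(\mathbb{X}_\theta)$ that are supertile-shuffling, i.e. the pairs $(\tau,A)$ defining supertile-shuffling extended symmetries.
   Context: Block substitutions: let $\mathcal{A}$ be a finite alphabet, $Q=\mathrm{diag}(\ell_1,\dots,\ell_d)$ with integers $\ell_j\ge 2$, and $\mathcal{D}=\prod_{j=1}^d\{0,\dots,\ell_j-1\}$. A block substitution is a map $\theta\colon\mathcal{A}\to\mathcal{A}^{\mathcal{D}}$; its columns are the maps $\theta_{\boldsymbol j}\colon\mathcal{A}\to\mathcal{A}$, $\theta_{\boldsymbol j}(a)=\theta(a)_{\boldsymbol j}$, $\boldsymbol j\in\mathcal{D}$. Its powers $\theta^n\colon\mathcal{A}\to\mathcal{A}^{\mathcal{D}^{(n)}}$ have support $\mathrm{supp}(\theta^n)=\mathcal{D}^{(n)}=\prod_j\{0,\dots,\ell_j^n-1\}$ and columns $\theta^n_{\boldsymbol j}=\theta_{\boldsymbol j_0}\circ\theta_{\boldsymbol j_1}\circ\cdots\circ\theta_{\boldsymbol j_{n-1}}$ for $\boldsymbol j=\sum_{i=0}^{n-1}Q^i\boldsymbol j_i$, $\boldsymbol j_i\in\mathcal{D}$. The language of $\theta$ is the set of finite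 patterns that occur (up to translation) in some $\theta^k(a)$, and $\mathbb{X}_\theta\subseteq\mathcal{A}^{\mathbb{Z}^d}$ is the subshift with this language (assumed well defined). $\theta$ is primitive if for some $k$ every $\theta^k(a)$ contains all letters; a primitive $\theta$ is aperiodic if no element of $\mathbb{X}_\theta$ has a non-zero period in $\mathbb{Z}^d$. Column number: $c_\theta=\min_{k\ge1}\min_{\boldsymbol j\in\mathrm{supp}(\theta^k)}|\theta^k_{\boldsymbol j}(\mathcal{A})|$. Extended symmetries: with $\sigma_{\boldsymbol n}(x)_{\boldsymbol i}=x_{\boldsymbol i+\boldsymbol n}$, $\mathcal{N}(\mathbb{X}_\theta)$ is the group of homeomorphisms $\Phi$ of $\mathbb{X}_\theta$ for which there is $A\in\mathrm{GL}(d,\mathbb{Z})$ with $\Phi\circ\sigma_{\boldsymbol n}=\sigma_{A\boldsymbol n}\circ\Phi$ for all $\boldsymbol n\in\mathbb{Z}^d$. Notation $\odot$: for a finite box $B\subset\mathbb{Z}^d$ let $\boldsymbol k=\boldsymbol k(B)$ be the (possibly half-integral) vector translating the centre of $B$ to the origin, and put $A\odot\boldsymbol n=A\boldsymbol n+A\boldsymbol k-\boldsymbol k$ for $\boldsymbol n\in B$. When applied to positions in $\mathrm{supp}(\theta^n)$, the box is $B=\mathrm{supp}(\theta^n)$. Supertile-shuffling: a pair $(\tau,A)$, with $\tau$ a permutation of $\mathcal{A}$ and $A\in\mathrm{GL}(d,\mathbb{Z})$ satisfying $A^{-1}\odot\mathrm{supp}(\theta^n)=\mathrm{supp}(\theta^n)$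 for all $n$, is supertile-shuffling if there is $N\in\mathbb{N}$ such that $\theta^n_{\boldsymbol i}(\tau(a))=\tau(\theta^n_{A^{-1}\odot\boldsymbol i}(a))$ for all $a\in\mathcal{A}$, $n\ge N$, $\boldsymbol i\in\mathrm{supp}(\theta^n)$. Such a pair defines the element $\Phi\in\mathcal{N}(\mathbb{X}_\theta)$ given by $\Phi(x)_{\boldsymbol n}=\tau(x_{A^{-1}\boldsymbol n})$, which is then called a supertile-shuffling extended symmetry. *)

theory Defs
  imports
    "HOL-Library.Nat_Bijection"
    "HOL-Combinatorics.Permutations"
    "HOL-Algebra.Bij"
    "HOL-Analysis.Function_Topology"
    "Jordan_Normal_Form.Matrix"
begin

section \<open>Partial recursive functions\<close>

text \<open>
  ``Algorithm'' means a program for a partial recursive function. \<^term>\<open>computes e xs y\<close> says that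
  \<^term>\<open>e\<close> halts on the arguments \<^term>\<open>xs\<close> with result \<^term>\<open>y\<close>.
\<close>

datatype recf =
    Zero
  | Succ
  | Proj nat
  | Comp recf "recf list"
  | Prec recf recf
  | Mu recf

inductive computes :: "recf \<Rightarrow> nat list \<Rightarrow> nat \<Rightarrow> bool" where
  zero: "computes Zero xs 0"
| succ: "computes Succ [x] (Suc x)"
| proj: "i < length xs \<Longrightarrow> computes (Proj i) xs (xs ! i)"
| comp: "list_all2 (\<lambda>g y. computes g xs y) gs ys \<Longrightarrow> computes f ys z \<Longrightarrow> computes (Comp f gs) xs z"
| prec_0: "computes f xs y \<Longrightarrow> computes (Prec f g) (0 # xs) y"
| prec_Suc: "computes (Prec f g) (n # xs) r \<Longrightarrow> computes g (n # r # xs) y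
    \<Longrightarrow> computes (Prec f g) (Suc n # xs) y"
| mu: "computes f (n # xs) 0 \<Longrightarrow> (\<And>i. i < n \<Longrightarrow> \<exists>v. computes f (i # xs) (Suc v))
    \<Longrightarrow> computes (Mu f) xs n"

lemma computes_deterministic:
  "computes e xs y \<Longrightarrow> computes e xs z \<Longrightarrow> y = z"
proof (induction arbitrary: z rule: computes.induct)
  case (comp xs gs ys f w)
  from comp.prems obtain ys' where *: "list_all2 (\<lambda>g y. computes g xs y) gs ys'" "computes f ys' z"
    by (cases rule: computes.cases) auto
  have "ys = ys'"
  proof (rule nth_equalityI)
    show "length ys = length ys'"
      using comp.IH(1) *(1) by (auto dest!: list_all2_lengthD)
    show "ys ! i = ys' ! i" if "i < length ys" for i
      using that comp.IH(1) *(1) by (auto simp: list_all2_conv_all_nth)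
  qed
  then show ?case using comp.IH(2) * by simp
next
  case (prec_0 f xs y g)
  from prec_0.prems show ?case by (cases rule: computes.cases) (auto intro: prec_0.IH)
next
  case (prec_Suc f g n xs r y)
  from prec_Suc.prems obtain r' where *: "computes (Prec f g) (n # xs) r'" "computes g (n # r' # xs) z"
    by (cases rule: computes.cases) auto
  then have "r = r'" by (intro prec_Suc.IH)
  with * show ?case by (intro prec_Suc.IH) simp
next
  case (mu f n xs)
  from mu.prems have *: "computes f (z # xs) 0" "\<And>i. i < z \<Longrightarrow> \<exists>v. computes f (i # xs) (Suc v)"
    by (cases rule: computes.cases, auto)+
  have "\<not> n < z" using *(2) mu.IH(1) by fastforce
  moreover have "\<not> z < n" using *(1) mu.IH(2) by fastforce
  ultimately show ?case by simp
qed (auto elim: computes.cases)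


section \<open>Block substitutions\<close>

text \<open>
  \<open>sides \<theta>\<close> is the list \<open>[\<ell>\<^sub>1, \<dots>, \<ell>\<^sub>d]\<close>, and \<open>rule \<theta> a j\<close> is the letter \<open>\<theta>(a)\<^sub>j\<close>.
  Elements of \<open>\<int>\<^sup>d\<close> are integer vectors in \<open>carrier_vec d\<close>.
\<close>

record 'a block_subst =
  sides :: "nat list"
  alphabet :: "'a set"
  rule :: "'a \<Rightarrow> int vec \<Rightarrow> 'a"

abbreviation rdim :: "'a block_subst \<Rightarrow> nat" where
  "rdim \<theta> \<equiv> length (sides \<theta>)"

abbreviation lattice :: "'a block_subst \<Rightarrow> int vec set" where
  "lattice \<theta> \<equiv> carrier_vec (rdim \<theta>)"

definition box :: "int vec \<Rightarrow> int vec \<Rightarrow> int vec set" where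
  "box lo hi = {v \<in> carrier_vec (dim_vec lo). \<forall>r < dim_vec lo. lo $ r \<le> v $ r \<and> v $ r \<le> hi $ r}"

definition supp_lo :: "'a block_subst \<Rightarrow> int vec" where
  "supp_lo \<theta> = 0\<^sub>v (rdim \<theta>)"

definition supp_hi :: "'a block_subst \<Rightarrow> nat \<Rightarrow> int vec" where
  "supp_hi \<theta> n = vec (rdim \<theta>) (\<lambda>r. int (sides \<theta> ! r) ^ n - 1)"

definition supp :: "'a block_subst \<Rightarrow> nat \<Rightarrow> int vec set" where
  "supp \<theta> n = box (supp_lo \<theta>) (supp_hi \<theta> n)"

definition block_substitution :: "'a block_subst \<Rightarrow> bool" where
  "block_substitution \<theta> \<longleftrightarrow>
     rdim \<theta> \<ge> 1 \<and> (\<forall>l \<in> set (sides \<theta>). l \<ge> 2) \<and>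
     finite (alphabet \<theta>) \<and> alphabet \<theta> \<noteq> {} \<and>
     (\<forall>a \<in> alphabet \<theta>. \<forall>j \<in> supp \<theta> 1. rule \<theta> a j \<in> alphabet \<theta>)"

text \<open>
  \<open>digit \<theta> i j\<close> is \<open>j\<^sub>i\<close> in the expansion \<open>j = \<Sum>\<^sub>i Q\<^sup>i j\<^sub>i\<close> with all \<open>j\<^sub>i\<close> in \<open>supp \<theta> 1\<close>, so
  \<open>column \<theta> n j\<close> is the composition \<open>\<theta>\<^bsub>j\<^sub>0\<^esub> \<circ> \<dots> \<circ> \<theta>\<^bsub>j\<^sub>n\<^sub>-\<^sub>1\<^esub>\<close>.
\<close>

definition digit :: "'a block_subst \<Rightarrow> nat \<Rightarrow> int vec \<Rightarrow> int vec" where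
  "digit \<theta> i j =
     vec (rdim \<theta>) (\<lambda>r. (j $ r div int (sides \<theta> ! r) ^ i) mod int (sides \<theta> ! r))"

definition column :: "'a block_subst \<Rightarrow> nat \<Rightarrow> int vec \<Rightarrow> 'a \<Rightarrow> 'a" where
  "column \<theta> n j = foldr (\<lambda>i f. (\<lambda>a. rule \<theta> a (digit \<theta> i j)) \<circ> f) [0..<n] id"

definition primitive :: "'a block_subst \<Rightarrow> bool" where
  "primitive \<theta> \<longleftrightarrow>
     (\<exists>k. \<forall>a \<in> alphabet \<theta>. \<forall>b \<in> alphabet \<theta>. \<exists>j \<in> supp \<theta> k. column \<theta> k j a = b)"

definition column_number :: "'a block_subst \<Rightarrow> nat" where
  "column_number \<theta> =
     (LEAST c. \<exists>k \<ge> 1. \<exists>j \<in> supp \<theta> k. c = card (column \<theta> k j ` alphabet \<theta>))"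


section \<open>The subshift and its extended symmetries\<close>

definition language :: "'a block_subst \<Rightarrow> (int vec \<rightharpoonup> 'a) set" where
  "language \<theta> =
     {p. finite (dom p) \<and> dom p \<subseteq> lattice \<theta> \<and>
         (\<exists>k. \<exists>a \<in> alphabet \<theta>. \<exists>t \<in> lattice \<theta>. \<forall>v \<in> dom p.
            v + t \<in> supp \<theta> k \<and> p v = Some (column \<theta> k (v + t) a))}"

definition subshift :: "'a block_subst \<Rightarrow> (int vec \<Rightarrow> 'a) set" where
  "subshift \<theta> =
     {x \<in> (\<Pi>\<^sub>E v \<in> lattice \<theta>. alphabet \<theta>).
        \<forall>S. finite S \<and> S \<subseteq> lattice \<theta> \<longrightarrow> (\<lambda>v. Some (x v)) |` S \<in> language \<theta>}"

definition shift :: "'a block_subst \<Rightarrow> int vec \<Rightarrow> (int vec \<Rightarrow> 'a) \<Rightarrow> (int vec \<Rightarrow> 'a)" where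
  "shift \<theta> n x = (\<lambda>i \<in> lattice \<theta>. x (i + n))"

definition aperiodic :: "'a block_subst \<Rightarrow> bool" where
  "aperiodic \<theta> \<longleftrightarrow>
     (\<forall>x \<in> subshift \<theta>. \<forall>n \<in> lattice \<theta>. shift \<theta> n x = x \<longrightarrow> n = 0\<^sub>v (rdim \<theta>))"

definition subshift_topology :: "'a block_subst \<Rightarrow> (int vec \<Rightarrow> 'a) topology" where
  "subshift_topology \<theta> =
     subtopology (product_topology (\<lambda>_. discrete_topology (alphabet \<theta>)) (lattice \<theta>)) (subshift \<theta>)"

definition GL_int :: "nat \<Rightarrow> int mat set" where
  "GL_int d = {A \<in> carrier_mat d d. invertible_mat A}"

definition extended_symmetry :: "'a block_subst \<Rightarrow> ((int vec \<Rightarrow> 'a) \<Rightarrow> (int vec \<Rightarrow> 'a)) \<Rightarrow> bool" where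
  "extended_symmetry \<theta> \<Phi> \<longleftrightarrow>
     \<Phi> \<in> extensional (subshift \<theta>) \<and>
     homeomorphic_map (subshift_topology \<theta>) (subshift_topology \<theta>) \<Phi> \<and>
     (\<exists>A \<in> GL_int (rdim \<theta>). \<forall>n \<in> lattice \<theta>. \<forall>x \<in> subshift \<theta>.
        \<Phi> (shift \<theta> n x) = shift \<theta> (A *\<^sub>v n) (\<Phi> x))"

definition extended_symmetry_group ::
    "'a block_subst \<Rightarrow> ((int vec \<Rightarrow> 'a) \<Rightarrow> (int vec \<Rightarrow> 'a)) monoid" where
  "extended_symmetry_group \<theta> = (BijGroup (subshift \<theta>))\<lparr>carrier := {\<Phi>. extended_symmetry \<theta> \<Phi>}\<rparr>"


section \<open>Supertile-shuffling pairs\<close>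

text \<open>Inverse in \<open>GL(d, \<int>)\<close>; meaningful for invertible square matrices only.\<close>

definition int_mat_inv :: "int mat \<Rightarrow> int mat" where
  "int_mat_inv A = (THE B. inverts_mat A B \<and> inverts_mat B A)"

lemma int_mat_inv_eqI:
  assumes "A \<in> carrier_mat d d" "inverts_mat A B" "inverts_mat B A"
  shows "int_mat_inv A = B"
  unfolding int_mat_inv_def
proof (rule the_equality)
  have carr: "C \<in> carrier_mat d d" if "inverts_mat A C" "inverts_mat C A" for C
  proof -
    have "dim_col (A * C) = dim_row A" "dim_col (C * A) = dim_row C"
      using that by (simp_all add: inverts_mat_def)
    then show ?thesis using assms(1) by auto
  qed
  fix C assume C: "inverts_mat A C \<and> inverts_mat C A"
  have "C = C * (A * B)"
    using assms carr[of C] C by (auto simp: inverts_mat_def)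
  also have "\<dots> = (C * A) * B"
    using assms carr[of C] carr[of B] C by (intro assoc_mult_mat[symmetric]) auto
  also have "\<dots> = B"
    using assms carr[of C] carr[of B] C by (auto simp: inverts_mat_def)
  finally show "C = B" .
qed (use assms in auto)

text \<open>
  \<open>box_shift lo hi\<close> is the translation \<open>k\<close> of the centre of \<open>box lo hi\<close> to the origin. It can be
  half-integral, so \<open>odot\<close> takes values in rational vectors.
\<close>

definition box_shift :: "int vec \<Rightarrow> int vec \<Rightarrow> rat vec" where
  "box_shift lo hi = vec (dim_vec lo) (\<lambda>r. - (rat_of_int (lo $ r + hi $ r) / 2))"

definition odot :: "int vec \<Rightarrow> int vec \<Rightarrow> int mat \<Rightarrow> int vec \<Rightarrow> rat vec" where
  "odot lo hi A n =
     (let k = box_shift lo hi; A' = map_mat rat_of_int A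
      in A' *\<^sub>v map_vec rat_of_int n + A' *\<^sub>v k - k)"

abbreviation odot_supp :: "'a block_subst \<Rightarrow> nat \<Rightarrow> int mat \<Rightarrow> int vec \<Rightarrow> rat vec" where
  "odot_supp \<theta> n \<equiv> odot (supp_lo \<theta>) (supp_hi \<theta> n)"

text \<open>
  In the last clause the position \<open>A\<^sup>-\<^sup>1 \<odot> i\<close> is the unique \<open>j\<close> in \<open>supp \<theta> n\<close> whose rational image is
  \<open>odot_supp \<theta> n (int_mat_inv A) i\<close>; it exists by the preceding clause.
\<close>

definition supertile_shuffling :: "'a block_subst \<Rightarrow> ('a \<Rightarrow> 'a) \<Rightarrow> int mat \<Rightarrow> bool" where
  "supertile_shuffling \<theta> \<tau> A \<longleftrightarrow>
     \<tau> permutes alphabet \<theta> \<and> A \<in> GL_int (rdim \<theta>) \<and>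
     (\<forall>n. odot_supp \<theta> n (int_mat_inv A) ` supp \<theta> n = map_vec rat_of_int ` supp \<theta> n) \<and>
     (\<exists>N. \<forall>a \<in> alphabet \<theta>. \<forall>n \<ge> N. \<forall>i \<in> supp \<theta> n. \<forall>j \<in> supp \<theta> n.
        map_vec rat_of_int j = odot_supp \<theta> n (int_mat_inv A) i \<longrightarrow>
        column \<theta> n i (\<tau> a) = \<tau> (column \<theta> n j a))"

definition induced_symmetry ::
    "'a block_subst \<Rightarrow> ('a \<Rightarrow> 'a) \<Rightarrow> int mat \<Rightarrow> ((int vec \<Rightarrow> 'a) \<Rightarrow> (int vec \<Rightarrow> 'a))" where
  "induced_symmetry \<theta> \<tau> A =
     (\<lambda>x \<in> subshift \<theta>. \<lambda>n \<in> lattice \<theta>. \<tau> (x (int_mat_inv A *\<^sub>v n)))"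

definition shuffling_symmetries :: "'a block_subst \<Rightarrow> ((int vec \<Rightarrow> 'a) \<Rightarrow> (int vec \<Rightarrow> 'a)) set" where
  "shuffling_symmetries \<theta> =
     {\<Phi> \<in> carrier (extended_symmetry_group \<theta>).
        \<exists>\<tau> A. supertile_shuffling \<theta> \<tau> A \<and> \<Phi> = induced_symmetry \<theta> \<tau> A}"


section \<open>Coding of inputs and outputs\<close>

text \<open>
  For alphabet \<open>{..<m}\<close>, the code consists of the side lengths and, for each letter \<open>a\<close>, the letters
  \<open>\<theta>(a)\<^sub>j\<close> listed in the lexicographic order of \<open>j\<close>.
\<close>

definition encode_subst :: "nat block_subst \<Rightarrow> nat" where
  "encode_subst \<theta> =
     prod_encode
       (list_encode (sides \<theta>),
        list_encode
          (map (\<lambda>a. list_encode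
                 (map (\<lambda>j. rule \<theta> a (vec_of_list (map int j)))
                   (product_lists (map (\<lambda>l. [0..<l]) (sides \<theta>)))))
            [0..<card (alphabet \<theta>)]))"

definition encode_pair :: "nat block_subst \<Rightarrow> (nat \<Rightarrow> nat) \<times> int mat \<Rightarrow> nat" where
  "encode_pair \<theta> = (\<lambda>(\<tau>, A).
     prod_encode
       (list_encode (map \<tau> [0..<card (alphabet \<theta>)]),
        list_encode (map (\<lambda>row. list_encode (map int_encode row)) (mat_to_list A))))"

end

theory Submission
  imports Defs "HOL-Library.More_List"
begin

text \<open>
  For a pair \<open>(\<tau>, A)\<close> there are only finitely many possibilities, and each of them can be checked in
  finitely many steps.

  \<^emph>\<open>Finitely many matrices.\<close> Put \<open>h\<^sub>r = \<ell>\<^sub>r - 1\<close>. The image under \<open>A\<close> of a suitable corner of the centred box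
  shows \<open>\<Sum>\<^sub>c \<bar>A\<^sub>r\<^sub>c\<bar> h\<^sub>c \<le> h\<^sub>r\<close> for each row \<open>r\<close>, and the same holds for \<open>A\<^sup>-\<^sup>1\<close>. Since \<open>A A\<^sup>-\<^sup>1 = 1\<close>, each row
  \<open>r\<close> has a column \<open>c\<close> in which \<open>A\<^sub>r\<^sub>c\<close> and \<open>(A\<^sup>-\<^sup>1)\<^sub>c\<^sub>r\<close> are nonzero integers. The two inequalities then force
  \<open>h\<^sub>c = h\<^sub>r\<close>, \<open>\<bar>A\<^sub>r\<^sub>c\<bar> = 1\<close>, and that the rest of the row vanishes. So \<open>A\<close> is a signed permutation matrix that
  respects the side lengths (\<open>box_preserving_imp_signed_perm\<close>); conversely each such matrix preserves
  the boxes of all levels.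

  \<^emph>\<open>A finite check.\<close> A signed permutation acts on the digits of a position one by one
  (\<open>reposition_glue\<close>). The condition at level \<open>n\<close> says that all pairs
  \<open>(\<theta>\<^sup>n\<^bsub>A\<odot>j\<^esub>(\<tau> a), \<theta>\<^sup>n\<^bsub>j\<^esub>(a))\<close> have the form \<open>(\<tau> c, c)\<close>. By the action on digits, the set of these pairs
  at level \<open>n + 1\<close> is the image of the set at level \<open>n\<close> under a map that does not depend on \<open>n\<close>
  (\<open>letter_pairs_Suc\<close>). A sequence of subsets of the square of the alphabet that is generated in this way
  is eventually periodic. So the condition holds for all large \<open>n\<close> if and only if it holds for the \<open>n\<close> in an
  explicit window (\<open>eventually_commuting_iff\<close>).

  \<^emph>\<open>The induced maps.\<close> By primitivity, each pattern of the language occurs in supertiles of arbitrarily high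
  level, where the commutation of \<open>(\<tau>, A)\<close> with the columns applies. So the induced map preserves the
  subshift; the inverse pair induces its inverse, and both are continuous
  (\<open>induced_symmetry_extended_symmetry\<close>).

  \<^emph>\<open>A program.\<close> The search is written as a function on lists (\<open>shuffling_pairs\<close>). Functions between coded
  types that are computed by a program are closed under the usual list operations, and these
  closure properties produce the program for the search (\<open>computable_shuffling_pairs\<close>).
\<close>

section \<open>Computable functions on coded types\<close>

text \<open>
  The codes of numbers, pairs and lists are those with which inputs and outputs are coded, so that a
  function on lists can be compared with a program directly.
\<close>

class coded =
  fixes encode :: "'a \<Rightarrow> nat"
  assumes inj_encode: "inj encode"

instantiation nat :: coded
begin
definition encode_nat :: "nat \<Rightarrow> nat" where [simp]: "encode_nat n = n"
instance by standard (simp add: inj_def)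
end

instantiation int :: coded
begin
definition encode_int :: "int \<Rightarrow> nat" where [simp]: "encode_int = int_encode"
instance by standard (simp add: inj_int_encode)
end

instantiation bool :: coded
begin
definition encode_bool :: "bool \<Rightarrow> nat" where [simp]: "encode_bool = of_bool"
instance by standard (simp add: inj_def)
end

instantiation prod :: (coded, coded) coded
begin
definition encode_prod :: "'a \<times> 'b \<Rightarrow> nat" where
  [simp]: "encode_prod p = prod_encode (encode (fst p), encode (snd p))"
instance
  by standard (auto simp: inj_def prod_encode_eq dest: injD[OF inj_encode])
end

instantiation list :: (coded) coded
begin
definition encode_list :: "'a list \<Rightarrow> nat" where
  "encode_list xs = list_encode (map encode xs)"
instance
  by standard (auto simp: inj_def encode_list_def list_encode_eq inj_map_eq_map[OF inj_encode])
end

lemma encode_Nil [simp]: "encode [] = 0"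
  and encode_Cons [simp]: "encode (y # ys) = Suc (prod_encode (encode y, encode ys))"
  by (simp_all add: encode_list_def)

lemma length_le_encode: "length xs \<le> encode xs"
proof (induction xs)
  case (Cons y ys)
  then show ?case
    using le_prod_encode_2[of "encode ys" "encode y"] by simp
qed simp

definition computable :: "('a::coded \<Rightarrow> 'b::coded) \<Rightarrow> bool" where
  "computable f \<longleftrightarrow> (\<exists>e. \<forall>x. computes e [encode x] (encode (f x)))"

lemma computableI: "(\<And>x. computes e [encode x] (encode (f x))) \<Longrightarrow> computable f"
  unfolding computable_def by blast

lemma computableE:
  assumes "computable f"
  obtains e where "\<And>x. computes e [encode x] (encode (f x))"
  using assms unfolding computable_def by blast

subsection \<open>Programs for pairing\<close>

lemma computes_Comp1: "computes g xs y \<Longrightarrow> computes f [y] z \<Longrightarrow> computes (Comp f [g]) xs z"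
  by (rule computes.comp[of _ _ "[y]"]) simp_all

lemma computes_Comp2:
  "computes g xs y \<Longrightarrow> computes g' xs y' \<Longrightarrow> computes f [y, y'] z \<Longrightarrow> computes (Comp f [g, g']) xs z"
  by (rule computes.comp[of _ _ "[y, y']"]) simp_all

lemma computes_Proj: "i < length xs \<Longrightarrow> y = xs ! i \<Longrightarrow> computes (Proj i) xs y"
  by (simp add: computes.proj)

definition add_prog :: recf where "add_prog = Prec (Proj 0) (Comp Succ [Proj 1])"
definition pred_prog :: recf where "pred_prog = Prec Zero (Proj 0)"
definition sub_prog :: recf where "sub_prog = Prec (Proj 0) (Comp pred_prog [Proj 1])"
definition triangle_prog :: recf where
  "triangle_prog = Prec Zero (Comp Succ [Comp add_prog [Proj 0, Proj 1]])"
definition pair_prog :: recf where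
  "pair_prog = Comp add_prog [Comp triangle_prog [Comp add_prog [Proj 0, Proj 1]], Proj 0]"
definition diag_prog :: recf where
  "diag_prog = Mu (Comp sub_prog [Comp triangle_prog [Comp Succ [Proj 0]], Comp Succ [Proj 1]])"
definition fst_prog :: recf where
  "fst_prog = Comp sub_prog [Comp triangle_prog [diag_prog], Proj 0]"
definition snd_prog :: recf where
  "snd_prog = Comp sub_prog [fst_prog, diag_prog]"

lemma computes_add: "computes add_prog [m, n] (m + n)"
  unfolding add_prog_def
proof (induction m)
  case 0
  show ?case by (rule computes.prec_0) (simp add: computes_Proj)
next
  case (Suc m)
  show ?case
    by (rule computes.prec_Suc[OF Suc])
      (auto intro!: computes_Comp1 computes_Proj computes.succ)
qed

lemma computes_pred: "computes pred_prog [n] (n - 1)"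
  unfolding pred_prog_def
proof (induction n)
  case 0
  show ?case by (auto intro: computes.prec_0 computes.zero)
next
  case (Suc n)
  show ?case by (rule computes.prec_Suc[OF Suc]) (simp add: computes_Proj)
qed

text \<open>Recursion is on the first argument, so \<^const>\<open>sub_prog\<close> takes the subtrahend first.\<close>

lemma computes_sub: "computes sub_prog [n, m] (m - n)"
  unfolding sub_prog_def
proof (induction n)
  case 0
  show ?case by (rule computes.prec_0) (simp add: computes_Proj)
next
  case (Suc n)
  have "computes (Comp pred_prog [Proj 1]) [n, m - n, m] (m - n - 1)"
    by (rule computes_Comp1[OF _ computes_pred]) (simp add: computes_Proj)
  then show ?case using computes.prec_Suc[OF Suc] by simp
qed

lemma computes_triangle: "computes triangle_prog [n] (triangle n)"
  unfolding triangle_prog_def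
proof (induction n)
  case 0
  show ?case by (auto intro: computes.prec_0 computes.zero)
next
  case (Suc n)
  have "computes (Comp Succ [Comp add_prog [Proj 0, Proj 1]]) [n, triangle n] (Suc (n + triangle n))"
    by (rule computes_Comp1[OF computes_Comp2[OF _ _ computes_add] computes.succ])
      (simp_all add: computes_Proj)
  then show ?case using computes.prec_Suc[OF Suc] by (simp add: add.commute)
qed

lemma computes_pair: "computes pair_prog [m, n] (prod_encode (m, n))"
  unfolding pair_prog_def prod_encode_def prod.case
  by (rule computes_Comp2[OF computes_Comp1[OF computes_Comp2[OF _ _ computes_add] computes_triangle]
        _ computes_add]) (simp_all add: computes_Proj)

lemma triangle_mono: "m \<le> n \<Longrightarrow> triangle m \<le> triangle n"
  by (induction rule: dec_induct) auto

text \<open>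
  The pairs \<open>(m, n)\<close> on the \<open>k\<close>-th antidiagonal \<open>m + n = k\<close> are coded by the numbers from
  \<open>triangle k\<close> to \<open>triangle (k + 1) - 1\<close>. So minimisation finds \<open>m + n\<close> from the code.
\<close>

lemma computes_diag: "computes diag_prog [prod_encode (m, n)] (m + n)"
proof -
  define z where "z = prod_encode (m, n)"
  have z: "z = triangle (m + n) + m" by (simp add: z_def prod_encode_def)
  have step: "computes (Comp sub_prog [Comp triangle_prog [Comp Succ [Proj 0]], Comp Succ [Proj 1]])
      [k, z] (Suc z - triangle (Suc k))" for k
    by (rule computes_Comp2[OF computes_Comp1[OF computes_Comp1[OF _ computes.succ] computes_triangle]
          computes_Comp1[OF _ computes.succ] computes_sub]) (simp_all add: computes_Proj)
  have "computes diag_prog [z] (m + n)"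
    unfolding diag_prog_def
  proof (rule computes.mu)
    have "Suc z - triangle (Suc (m + n)) = 0" by (simp add: z)
    then show "computes (Comp sub_prog [Comp triangle_prog [Comp Succ [Proj 0]], Comp Succ [Proj 1]])
      [m + n, z] 0" using step[of "m + n"] by simp
    fix i assume "i < m + n"
    then have "triangle (Suc i) \<le> z" using triangle_mono[of "Suc i" "m + n"] z by simp
    then have "Suc z - triangle (Suc i) = Suc (z - triangle (Suc i))" by simp
    then show "\<exists>v. computes (Comp sub_prog
        [Comp triangle_prog [Comp Succ [Proj 0]], Comp Succ [Proj 1]]) [i, z] (Suc v)"
      using step[of i] by metis
  qed
  then show ?thesis by (simp add: z_def)
qed

lemma computes_fst: "computes fst_prog [prod_encode (m, n)] m"
proof -
  have "computes fst_prog [prod_encode (m, n)] (prod_encode (m, n) - triangle (m + n))"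
    unfolding fst_prog_def
    by (rule computes_Comp2[OF computes_Comp1[OF computes_diag computes_triangle] _ computes_sub])
      (simp add: computes_Proj)
  then show ?thesis by (simp add: prod_encode_def)
qed

lemma computes_snd: "computes snd_prog [prod_encode (m, n)] n"
  using computes_Comp2[OF computes_fst computes_diag computes_sub, of m n]
  unfolding snd_prog_def by simp

subsection \<open>Closure properties\<close>

text \<open>
  The rules carry a parameter \<open>x\<close> along and allow their arguments to depend on it, so that together they
  decompose any expression built from the operations. A function with several arguments is taken as a
  function of a nested pair, in which its arguments appear as projections.
\<close>

named_theorems computable_intros

lemma computable_id [computable_intros]: "computable (\<lambda>x. x)"
  by (rule computableI[of "Proj 0"]) (simp add: computes_Proj)

lemma computable_const [computable_intros]: "computable (\<lambda>x. c)"
proof -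
  have "\<exists>e. \<forall>x. computes e [x] n" for n
  proof (induction n)
    case 0
    show ?case using computes.zero by blast
  next
    case (Suc n)
    then show ?case using computes_Comp1[OF _ computes.succ] by blast
  qed
  then show ?thesis unfolding computable_def by blast
qed

lemma computable_compose:
  assumes "computable g" "computable f"
  shows "computable (\<lambda>x. g (f x))"
proof -
  obtain a b where "\<And>x. computes a [encode x] (encode (g x))" "\<And>x. computes b [encode x] (encode (f x))"
    using assms by (auto elim!: computableE)
  then show ?thesis by (intro computableI[of "Comp a [b]"]) (blast intro: computes_Comp1)
qed

lemma computable_Pair [computable_intros]:
  assumes "computable f" "computable g"
  shows "computable (\<lambda>x. (f x, g x))"
proof -
  obtain a b where "\<And>x. computes a [encode x] (encode (f x))" "\<And>x. computes b [encode x] (encode (g x))"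
    using assms by (auto elim!: computableE)
  then show ?thesis
    by (intro computableI[of "Comp pair_prog [a, b]"]) (auto intro!: computes_Comp2 computes_pair)
qed

lemma computable_compose2:
  assumes "computable (\<lambda>p. f (fst p) (snd p))" "computable a" "computable b"
  shows "computable (\<lambda>x. f (a x) (b x))"
  using computable_compose[OF assms(1) computable_Pair[OF assms(2,3)]] by simp

lemma computable_compose3:
  assumes "computable (\<lambda>p. f (fst p) (fst (snd p)) (snd (snd p)))" "computable a" "computable b" "computable c"
  shows "computable (\<lambda>x. f (a x) (b x) (c x))"
  using computable_compose[OF assms(1) computable_Pair[OF assms(2) computable_Pair[OF assms(3,4)]]] by simp

lemma computable_fst [computable_intros]: "computable f \<Longrightarrow> computable (\<lambda>x. fst (f x))"
  by (rule computable_compose[of fst], rule computableI[of fst_prog]) (simp_all add: computes_fst)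

lemma computable_snd [computable_intros]: "computable f \<Longrightarrow> computable (\<lambda>x. snd (f x))"
  by (rule computable_compose[of snd], rule computableI[of snd_prog]) (simp_all add: computes_snd)

lemma computable_Suc [computable_intros]: "computable f \<Longrightarrow> computable (\<lambda>x. Suc (f x))"
  by (rule computable_compose[of Suc], rule computableI[of Succ]) (simp_all add: computes.succ)

text \<open>
  On codes, \<^const>\<open>encode\<close> is the identity.
\<close>

lemma computable_encode: "computable f \<Longrightarrow> computable (\<lambda>x. encode (f x))"
  by (rule computable_compose[of encode], rule computableI[of "Proj 0"]) (simp_all add: computes_Proj)

lemma computable_rec_nat [computable_intros]:
  assumes n: "computable n" and f: "computable f"
    and g: "computable (\<lambda>p. g (fst p) (fst (snd p)) (snd (snd p)))"
  shows "computable (\<lambda>x. rec_nat (f x) (g x) (n x))"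
proof -
  obtain en where en: "\<And>x. computes en [encode x] (n x)"
    using n unfolding computable_def by auto
  obtain ef where ef: "\<And>x. computes ef [encode x] (encode (f x))"
    using f by (auto elim!: computableE)
  obtain eg where "\<And>p. computes eg [encode p] (encode (g (fst p) (fst (snd p)) (snd (snd p))))"
    by (rule computableE[OF g]) blast
  then have eg: "computes eg [prod_encode (encode x, prod_encode (k, encode r))] (encode (g x k r))" for x k r
    by (metis encode_nat_def encode_prod_def fst_conv snd_conv)
  \<comment> \<open>The arguments of the step function are the counter, the previous value and the parameter.\<close>
  define h where "h = Comp eg [Comp pair_prog [Proj 2, Comp pair_prog [Proj 0, Proj 1]]]"
  have h: "computes h [k, encode r, encode x] (encode (g x k r))" for k r x
    unfolding h_def
    by (rule computes_Comp1[OF computes_Comp2[OF _ computes_Comp2[OF _ _ computes_pair] computes_pair] eg])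
      (simp_all add: computes_Proj)
  have "computes (Prec ef h) [k, encode x] (encode (rec_nat (f x) (g x) k))" for k x
    by (induction k) (use ef h in \<open>auto intro: computes.prec_0 computes.prec_Suc\<close>)
  note prec = this
  have "computes (Comp (Prec ef h) [en, Proj 0]) [encode x] (encode (rec_nat (f x) (g x) (n x)))" for x
    by (rule computes_Comp2[OF en _ prec]) (simp add: computes_Proj)
  then show ?thesis by (rule computableI)
qed

lemma computable_if [computable_intros]:
  assumes b: "computable b" and "computable f" "computable g"
  shows "computable (\<lambda>x. if b x then f x else g x)"
proof -
  have "(\<lambda>x. if b x then f x else g x) = (\<lambda>x. rec_nat (g x) (\<lambda>_ _. f x) (encode (b x)))"
    by auto
  moreover have "computable (\<lambda>x. rec_nat (g x) (\<lambda>_ _. f x) (encode (b x)))"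
    by (intro computable_rec_nat computable_encode assms computable_compose[OF assms(2)] computable_intros)
  ultimately show ?thesis by simp
qed

text \<open>
  The two sides of a case distinction cannot be evaluated eagerly: the second program need not halt
  on the codes that arise from decoding the empty list. Primitive recursion on the sign of the code
  runs it only when the list is nonempty.
\<close>

lemma computable_case_list [computable_intros]:
  assumes l: "computable l" and f: "computable f"
    and g: "computable (\<lambda>p. g (fst p) (fst (snd p)) (snd (snd p)))"
  shows "computable (\<lambda>x. case l x of [] \<Rightarrow> f x | y # ys \<Rightarrow> g x y ys)"
proof -
  obtain el where el: "\<And>x. computes el [encode x] (encode (l x))"
    using l by (auto elim!: computableE)
  obtain ef where ef: "\<And>x. computes ef [encode x] (encode (f x))"
    using f by (auto elim!: computableE)
  obtain eg where "\<And>p. computes eg [encode p] (encode (g (fst p) (fst (snd p)) (snd (snd p))))"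
    by (rule computableE[OF g]) blast
  then have eg: "computes eg [prod_encode (encode x, prod_encode (encode y, encode ys))]
      (encode (g x y ys))" for x y ys
    by (metis encode_prod_def fst_conv snd_conv)
  define sgn_prog where "sgn_prog = Comp (Prec Zero (Comp Succ [Zero])) [el]"
  have sgn0: "computes sgn_prog [encode x] 0" if "l x = []" for x
    unfolding sgn_prog_def using el[of x] that
    by (intro computes_Comp1[of el _ 0] computes.prec_0 computes.zero) simp
  have sgn1: "computes sgn_prog [encode x] (Suc 0)" if "l x = y # ys" for x y ys
  proof -
    have one: "computes (Comp Succ [Zero]) zs (Suc 0)" for zs
      by (rule computes_Comp1[OF computes.zero computes.succ])
    have "\<exists>r. computes (Prec Zero (Comp Succ [Zero])) [n] r" for n
      by (induction n) (auto intro: computes.prec_0 computes.zero computes.prec_Suc one)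
    then show ?thesis
      unfolding sgn_prog_def
      using computes_Comp1[OF el[of x]] computes.prec_Suc[OF _ one] that by (auto simp del: encode_list_def) blast
  qed
  define h where "h = Comp eg [Comp pair_prog [Proj 2, Comp pred_prog [Comp el [Proj 2]]]]"
  have h: "computes h [0, r, encode x] (encode (g x y ys))" if "l x = y # ys" for r x y ys
  proof -
    have "computes (Comp el [Proj 2]) [0, r, encode x] (Suc (prod_encode (encode y, encode ys)))"
      using el[of x] that by (intro computes_Comp1[of "Proj 2" _ "encode x"]) (simp_all add: computes_Proj)
    from computes_Comp1[OF this computes_pred]
    have "computes (Comp pred_prog [Comp el [Proj 2]]) [0, r, encode x] (prod_encode (encode y, encode ys))"
      by simp
    then show ?thesis
      unfolding h_def
      by (intro computes_Comp1[OF computes_Comp2[OF _ _ computes_pair] eg]) (simp_all add: computes_Proj)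
  qed
  have "computes (Comp (Prec ef h) [sgn_prog, Proj 0]) [encode x]
      (encode (case l x of [] \<Rightarrow> f x | y # ys \<Rightarrow> g x y ys))" for x
  proof (cases "l x")
    case Nil
    show ?thesis
      unfolding Nil list.case
      by (rule computes_Comp2[OF sgn0[OF Nil] _ computes.prec_0[OF ef]]) (simp add: computes_Proj)
  next
    case (Cons y ys)
    show ?thesis
      unfolding Cons list.case
      by (rule computes_Comp2[OF sgn1[OF Cons] _ computes.prec_Suc[OF computes.prec_0[OF ef] h[OF Cons]]])
        (simp add: computes_Proj)
  qed
  then show ?thesis by (rule computableI)
qed

lemma computable_funpow [computable_intros]:
  fixes f :: "'a::coded \<Rightarrow> 'b::coded \<Rightarrow> 'b"
  assumes n: "computable n" and a: "computable a" and f: "computable (\<lambda>p. f (fst p) (snd p))"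
  shows "computable (\<lambda>x. (f x ^^ n x) (a x))"
proof -
  have "(f x ^^ k) b = rec_nat b (\<lambda>_. f x) k" for x k b
    by (induction k) simp_all
  then have "(\<lambda>x. (f x ^^ n x) (a x)) = (\<lambda>x. rec_nat (a x) (\<lambda>_. f x) (n x))"
    by simp
  moreover have "computable (\<lambda>p. f (fst p) (snd (snd p)))"
    by (rule computable_compose[OF f, of "\<lambda>p. (fst p, snd (snd p))", simplified]) (intro computable_intros)
  then have "computable (\<lambda>x. rec_nat (a x) (\<lambda>_. f x) (n x))"
    by (intro computable_rec_nat n a)
  ultimately show ?thesis by simp
qed

subsection \<open>Arithmetic and logic\<close>

lemma computable_add [computable_intros]:
  assumes "computable f" "computable g"
  shows "computable (\<lambda>x. f x + g x :: nat)"
proof -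
  have "f x + g x = rec_nat (f x) (\<lambda>_. Suc) (g x)" for x
  proof -
    have "a + b = rec_nat a (\<lambda>_. Suc) b" for a b :: nat by (induction b) simp_all
    then show ?thesis .
  qed
  then show ?thesis by (simp only:) (intro computable_intros assms)
qed

lemma computable_diff [computable_intros]:
  assumes "computable f" "computable g"
  shows "computable (\<lambda>x. f x - g x :: nat)"
proof -
  have pred: "computable (\<lambda>x. h x - 1 :: nat)" if "computable h" for h :: "'c::coded \<Rightarrow> nat"
  proof -
    have "n - 1 = rec_nat 0 (\<lambda>k _. k) n" for n :: nat by (cases n) simp_all
    then show ?thesis by (simp only:) (intro computable_intros that)
  qed
  have "a - b = rec_nat a (\<lambda>_ r. r - 1) b" for a b :: nat by (induction b) simp_all
  then have "(\<lambda>x. f x - g x) = (\<lambda>x. rec_nat (f x) (\<lambda>_ r. r - 1) (g x))" by blast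
  moreover have "computable (\<lambda>x. rec_nat (f x) (\<lambda>_ r. r - 1) (g x))"
    by (intro computable_rec_nat computable_intros assms pred)
  ultimately show ?thesis by simp
qed

lemma computable_mult [computable_intros]:
  assumes "computable f" "computable g"
  shows "computable (\<lambda>x. f x * g x :: nat)"
proof -
  have "a * b = rec_nat 0 (\<lambda>_ r. r + a) b" for a b :: nat by (induction b) simp_all
  then show ?thesis
    by (simp only:) (intro computable_rec_nat computable_intros assms computable_compose[OF assms(1)])
qed

lemma computable_power [computable_intros]:
  assumes "computable f" "computable g"
  shows "computable (\<lambda>x. f x ^ g x :: nat)"
proof -
  have "a ^ b = rec_nat 1 (\<lambda>_ r. r * a) b" for a b :: nat by (induction b) simp_all
  then show ?thesis
    by (simp only:) (intro computable_rec_nat computable_intros assms computable_compose[OF assms(1)])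
qed

lemma computable_conj [computable_intros]:
  assumes "computable P" "computable Q"
  shows "computable (\<lambda>x. P x \<and> Q x)"
proof -
  have "P x \<and> Q x \<longleftrightarrow> (if P x then Q x else False)" for x by simp
  then show ?thesis by (simp only:) (intro computable_if computable_const assms)
qed

lemma computable_disj [computable_intros]:
  assumes "computable P" "computable Q"
  shows "computable (\<lambda>x. P x \<or> Q x)"
proof -
  have "P x \<or> Q x \<longleftrightarrow> (if P x then True else Q x)" for x by simp
  then show ?thesis by (simp only:) (intro computable_if computable_const assms)
qed

text \<open>
  Codes are injective, so equality in any coded type reduces to equality of numbers.
\<close>

lemma computable_eq [computable_intros]:
  fixes f g :: "'a::coded \<Rightarrow> 'b::coded"
  assumes "computable f" "computable g"
  shows "computable (\<lambda>x. f x = g x)"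
proof -
  have is_zero: "n = 0 \<longleftrightarrow> rec_nat True (\<lambda>_ _. False) n" for n :: nat by (cases n) simp_all
  have "f x = g x \<longleftrightarrow> (encode (f x) - encode (g x)) + (encode (g x) - encode (f x)) = 0" for x
    using inj_eq[OF inj_encode, of "f x" "g x"] by auto
  then show ?thesis
    unfolding is_zero by (simp only:) (intro computable_rec_nat computable_intros computable_encode assms)
qed

subsection \<open>Lists\<close>

lemma computable_Cons [computable_intros]:
  assumes "computable f" "computable g"
  shows "computable (\<lambda>x. f x # g x)"
proof -
  obtain a b where "\<And>x. computes a [encode x] (encode (f x))" "\<And>x. computes b [encode x] (encode (g x))"
    using assms by (auto elim!: computableE)
  then show ?thesis
    by (intro computableI[of "Comp Succ [Comp pair_prog [a, b]]"])
      (auto intro!: computes_Comp1[OF computes_Comp2] computes_pair computes.succ)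
qed

text \<open>
  The code of a list bounds its length. So enough steps of the loop \<open>(a, y # ys) \<mapsto> (h a y, ys)\<close>
  have been made after as many iterations as the code of the list says.
\<close>

lemma computable_foldl [computable_intros]:
  assumes l: "computable l" and a: "computable a"
    and h: "computable (\<lambda>p. h (fst p) (fst (snd p)) (snd (snd p)))"
  shows "computable (\<lambda>x. foldl (h x) (a x) (l x))"
proof -
  define step where
    "step x s = (case snd s of [] \<Rightarrow> (fst s, []) | y # ys \<Rightarrow> (h x (fst s) y, ys))" for x s
  have loop: "(step x ^^ n) (b, ys) = (foldl (h x) b (take n ys), drop n ys)" for x n b ys
  proof (induction n arbitrary: b ys)
    case (Suc n)
    then show ?case by (cases ys) (simp_all add: step_def funpow_Suc_right del: funpow.simps)
  qed simp
  have "foldl (h x) (a x) (l x) = fst ((step x ^^ encode (l x)) (a x, l x))" for x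
    using length_le_encode[of "l x"] by (simp add: loop)
  moreover have "computable (\<lambda>p. step (fst p) (snd p))"
    unfolding step_def
    by (intro computable_intros
        computable_compose[OF h, of "\<lambda>p. (fst (fst p), fst (snd (fst p)), fst (snd p))", simplified])
  then have "computable (\<lambda>x. fst ((step x ^^ encode (l x)) (a x, l x)))"
    by (intro computable_intros computable_encode l a)
  ultimately show ?thesis by simp
qed

lemma computable_rev [computable_intros]:
  assumes "computable l"
  shows "computable (\<lambda>x. rev (l x))"
proof -
  have "foldl (\<lambda>acc y. y # acc) acc ys = rev ys @ acc" for ys acc :: "'b list"
    by (induction ys arbitrary: acc) simp_all
  then have "rev ys = foldl (\<lambda>acc y. y # acc) [] ys" for ys :: "'b list" by simp
  then show ?thesis by (simp only:) (intro computable_intros assms)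
qed

lemma computable_foldr [computable_intros]:
  assumes l: "computable l" and a: "computable a"
    and h: "computable (\<lambda>p. h (fst p) (fst (snd p)) (snd (snd p)))"
  shows "computable (\<lambda>x. foldr (h x) (l x) (a x))"
  unfolding foldr_conv_foldl
  by (intro computable_intros l a
      computable_compose[OF h, of "\<lambda>p. (fst p, snd (snd p), fst (snd p))", simplified])

lemma computable_append [computable_intros]:
  assumes "computable f" "computable g"
  shows "computable (\<lambda>x. f x @ g x)"
proof -
  have "ys @ zs = foldr (#) ys zs" for ys zs :: "'b list" by (induction ys) simp_all
  then show ?thesis by (simp only:) (intro computable_intros assms)
qed

lemma computable_map [computable_intros]:
  assumes l: "computable l" and h: "computable (\<lambda>p. h (fst p) (snd p))"
  shows "computable (\<lambda>x. map (h x) (l x))"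
proof -
  have "map (h x) ys = foldr (\<lambda>y acc. h x y # acc) ys []" for x ys by (induction ys) simp_all
  then show ?thesis
    by (simp only:) (intro computable_intros l
      computable_compose[OF h, of "\<lambda>p. (fst p, fst (snd p))", simplified])
qed

lemma computable_concat [computable_intros]:
  assumes "computable l"
  shows "computable (\<lambda>x. concat (l x))"
  unfolding concat_conv_foldr by (intro computable_intros assms)

lemma computable_filter [computable_intros]:
  assumes l: "computable l" and h: "computable (\<lambda>p. h (fst p) (snd p))"
  shows "computable (\<lambda>x. filter (h x) (l x))"
proof -
  have "filter (h x) ys = foldr (\<lambda>y acc. if h x y then y # acc else acc) ys []" for x ys
    by (induction ys) simp_all
  then show ?thesis
    by (simp only:) (intro computable_intros l
      computable_compose[OF h, of "\<lambda>p. (fst p, fst (snd p))", simplified])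
qed

lemma computable_Ball [computable_intros]:
  assumes l: "computable l" and h: "computable (\<lambda>p. h (fst p) (snd p))"
  shows "computable (\<lambda>x. \<forall>y\<in>set (l x). h x y)"
proof -
  have "(\<forall>y\<in>set ys. h x y) \<longleftrightarrow> foldr (\<lambda>y b. h x y \<and> b) ys True" for x ys
    by (induction ys) simp_all
  then show ?thesis
    by (simp only:) (intro computable_intros l
      computable_compose[OF h, of "\<lambda>p. (fst p, fst (snd p))", simplified])
qed

lemma computable_Bex [computable_intros]:
  assumes l: "computable l" and h: "computable (\<lambda>p. h (fst p) (snd p))"
  shows "computable (\<lambda>x. \<exists>y\<in>set (l x). h x y)"
proof -
  have "(\<exists>y\<in>set ys. h x y) \<longleftrightarrow> foldr (\<lambda>y b. h x y \<or> b) ys False" for x ys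
    by (induction ys) simp_all
  then show ?thesis
    by (simp only:) (intro computable_intros l
      computable_compose[OF h, of "\<lambda>p. (fst p, fst (snd p))", simplified])
qed

lemma computable_length [computable_intros]:
  assumes "computable l"
  shows "computable (\<lambda>x. length (l x))"
proof -
  have "length ys = foldr (\<lambda>_. Suc) ys 0" for ys :: "'b list" by (induction ys) simp_all
  then show ?thesis by (simp only:) (intro computable_intros assms)
qed

lemma computable_upt [computable_intros]:
  assumes "computable n"
  shows "computable (\<lambda>x. [0..<n x])"
proof -
  have "[0..<k] = rec_nat [] (\<lambda>i r. r @ [i]) k" for k by (induction k) simp_all
  then show ?thesis by (simp only:) (intro computable_intros assms)
qed

text \<open>
  The default makes the access total. A plain \<^const>\<open>nth\<close> is unspecified beyond the end of the list,
  so nothing could be proved about its computability.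
\<close>

lemma computable_nth_default [computable_intros]:
  assumes "computable d" "computable l" "computable n"
  shows "computable (\<lambda>x. nth_default (d x) (l x) (n x))"
proof -
  have "nth_default e ys k = (case (((\<lambda>zs. case zs of [] \<Rightarrow> [] | z # zs' \<Rightarrow> zs') ^^ k) ys) of
      [] \<Rightarrow> e | z # zs \<Rightarrow> z)" for e :: 'b and ys k
  proof (induction k arbitrary: ys)
    case 0
    show ?case by (cases ys) simp_all
  next
    case (Suc k)
    have "((\<lambda>zs. case zs of [] \<Rightarrow> [] | z # zs' \<Rightarrow> zs') ^^ k) [] = ([] :: 'b list)"
      by (induction k) simp_all
    with Suc show ?case by (cases ys) (simp_all add: funpow_Suc_right del: funpow.simps)
  qed
  then show ?thesis by (simp only:) (intro computable_intros assms)
qed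

lemma computable_product [computable_intros]:
  assumes f: "computable f" and g: "computable g"
  shows "computable (\<lambda>x. List.product (f x) (g x))"
proof -
  have "computable (\<lambda>p. g (fst p))"
    by (rule computable_compose[OF g]) (intro computable_intros)
  then have "computable (\<lambda>x. concat (map (\<lambda>y. map (Pair y) (g x)) (f x)))"
    by (intro computable_intros f)
  then show ?thesis by (simp only: product_concat_map)
qed

lemma computable_product_lists [computable_intros]:
  assumes "computable l"
  shows "computable (\<lambda>x. product_lists (l x))"
proof -
  have "product_lists ls = foldr (\<lambda>ys acc. concat (map (\<lambda>y. map ((#) y) acc) ys)) ls [[]]"
    for ls :: "'b list list"
    by (induction ls) simp_all
  then show ?thesis by (simp only:) (intro computable_intros assms)
qed

section \<open>Symmetries of the boxes\<close>

definition signed_perm_mat :: "nat \<Rightarrow> (nat \<Rightarrow> nat) \<Rightarrow> (nat \<Rightarrow> bool) \<Rightarrow> int mat" where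
  "signed_perm_mat d \<pi> s = mat d d (\<lambda>(r, c). if c = \<pi> r then if s r then 1 else -1 else 0)"

definition side_perm :: "'a block_subst \<Rightarrow> (nat \<Rightarrow> nat) \<Rightarrow> bool" where
  "side_perm \<theta> \<pi> \<longleftrightarrow> bij_betw \<pi> {..<rdim \<theta>} {..<rdim \<theta>} \<and>
     (\<forall>r < rdim \<theta>. sides \<theta> ! \<pi> r = sides \<theta> ! r)"

text \<open>
  Twice the coordinates relative to the centre of the box of level \<open>n\<close>. The factor \<open>2\<close> avoids half-integers.
\<close>

definition centred :: "'a block_subst \<Rightarrow> nat \<Rightarrow> int vec \<Rightarrow> int vec" where
  "centred \<theta> n j = vec (rdim \<theta>) (\<lambda>r. 2 * j $ r - (int (sides \<theta> ! r) ^ n - 1))"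

text \<open>
  The position \<open>A \<odot> j\<close> in the box of level \<open>n\<close> for \<open>A = signed_perm_mat d \<pi> s\<close>; the axes on which
  \<open>s\<close> is false are reflected.
\<close>

definition reposition ::
    "'a block_subst \<Rightarrow> (nat \<Rightarrow> nat) \<Rightarrow> (nat \<Rightarrow> bool) \<Rightarrow> nat \<Rightarrow> int vec \<Rightarrow> int vec" where
  "reposition \<theta> \<pi> s n j = vec (rdim \<theta>)
     (\<lambda>r. if s r then j $ \<pi> r else int (sides \<theta> ! r) ^ n - 1 - j $ \<pi> r)"

lemma mult_mat_vec_index:
  assumes "A \<in> carrier_mat d d" "v \<in> carrier_vec d" "r < d"
  shows "(A *\<^sub>v v) $ r = (\<Sum>c<d. A $$ (r, c) * v $ c)"
  using assms by (auto simp: scalar_prod_def atLeast0LessThan)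

lemma signed_perm_mat_carrier [simp]: "signed_perm_mat d \<pi> s \<in> carrier_mat d d"
  by (simp add: signed_perm_mat_def)

lemma signed_perm_mat_mult_vec:
  assumes "v \<in> carrier_vec d" "r < d" "\<pi> r < d"
  shows "(signed_perm_mat d \<pi> s *\<^sub>v v) $ r = (if s r then v $ \<pi> r else - v $ \<pi> r)"
proof -
  have "(signed_perm_mat d \<pi> s *\<^sub>v v) $ r
      = (\<Sum>c<d. if c = \<pi> r then if s r then v $ \<pi> r else - v $ \<pi> r else 0)"
    unfolding mult_mat_vec_index[OF signed_perm_mat_carrier assms(1,2)]
    by (rule sum.cong) (use assms in \<open>auto simp: signed_perm_mat_def\<close>)
  then show ?thesis using assms by simp
qed

lemma signed_perm_mat_mult:
  assumes "\<And>r. r < d \<Longrightarrow> \<pi> r < d"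
  shows "signed_perm_mat d \<pi> s * signed_perm_mat d \<pi>' s'
    = signed_perm_mat d (\<pi>' \<circ> \<pi>) (\<lambda>r. s r = s' (\<pi> r))"
proof (rule eq_matI)
  fix r c assume rc: "r < dim_row (signed_perm_mat d (\<pi>' \<circ> \<pi>) (\<lambda>r. s r = s' (\<pi> r)))"
    "c < dim_col (signed_perm_mat d (\<pi>' \<circ> \<pi>) (\<lambda>r. s r = s' (\<pi> r)))"
  then have "r < d" "c < d" by (simp_all add: signed_perm_mat_def)
  then have "(signed_perm_mat d \<pi> s * signed_perm_mat d \<pi>' s') $$ (r, c)
      = (signed_perm_mat d \<pi> s *\<^sub>v col (signed_perm_mat d \<pi>' s') c) $ r"
    by (simp add: signed_perm_mat_def)
  also have "\<dots> = signed_perm_mat d (\<pi>' \<circ> \<pi>) (\<lambda>r. s r = s' (\<pi> r)) $$ (r, c)"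
    using \<open>r < d\<close> \<open>c < d\<close> assms[of r]
    by (subst signed_perm_mat_mult_vec) (auto simp: signed_perm_mat_def)
  finally show "(signed_perm_mat d \<pi> s * signed_perm_mat d \<pi>' s') $$ (r, c)
      = signed_perm_mat d (\<pi>' \<circ> \<pi>) (\<lambda>r. s r = s' (\<pi> r)) $$ (r, c)" .
qed (simp_all add: signed_perm_mat_def)

text \<open>
  The inverse belongs to the inverse permutation, with the signs moved along.
\<close>

lemma signed_perm_mat_inverse:
  assumes "bij_betw \<pi> {..<d} {..<d}"
  obtains B where "B \<in> carrier_mat d d" "signed_perm_mat d \<pi> s * B = 1\<^sub>m d" "B * signed_perm_mat d \<pi> s = 1\<^sub>m d"
proof
  define \<rho> where "\<rho> = inv_into {..<d} \<pi>"
  have \<pi>: "\<pi> r < d" "\<rho> (\<pi> r) = r" if "r < d" for r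
    using that assms by (auto simp: \<rho>_def bij_betw_def)
  have \<rho>: "\<rho> r < d" "\<pi> (\<rho> r) = r" if "r < d" for r
    using that assms bij_betw_inv_into[OF assms]
    by (auto simp: \<rho>_def bij_betw_inv_into_right dest: bij_betwE)
  let ?B = "signed_perm_mat d \<rho> (s \<circ> \<rho>)"
  show "?B \<in> carrier_mat d d" by simp
  have "signed_perm_mat d \<pi> s * ?B = signed_perm_mat d (\<rho> \<circ> \<pi>) (\<lambda>r. s r = (s \<circ> \<rho>) (\<pi> r))"
    by (rule signed_perm_mat_mult) (rule \<pi>)
  also have "\<dots> = 1\<^sub>m d" by (rule eq_matI) (auto simp: signed_perm_mat_def \<pi>)
  finally show "signed_perm_mat d \<pi> s * ?B = 1\<^sub>m d" .
  have "?B * signed_perm_mat d \<pi> s = signed_perm_mat d (\<pi> \<circ> \<rho>) (\<lambda>r. (s \<circ> \<rho>) r = s (\<rho> r))"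
    by (rule signed_perm_mat_mult) (rule \<rho>)
  also have "\<dots> = 1\<^sub>m d" by (rule eq_matI) (auto simp: signed_perm_mat_def \<rho>)
  finally show "?B * signed_perm_mat d \<pi> s = 1\<^sub>m d" .
qed

lemma GL_int_inverse:
  assumes "A \<in> GL_int d"
  shows "int_mat_inv A \<in> GL_int d" "int_mat_inv A \<in> carrier_mat d d"
    "A * int_mat_inv A = 1\<^sub>m d" "int_mat_inv A * A = 1\<^sub>m d" "int_mat_inv (int_mat_inv A) = A"
proof -
  have A: "A \<in> carrier_mat d d" using assms by (simp add: GL_int_def)
  obtain B where B: "inverts_mat A B" "inverts_mat B A"
    using assms by (auto simp: GL_int_def invertible_mat_def)
  have eq: "int_mat_inv A = B" by (rule int_mat_inv_eqI[OF A B])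
  have "dim_col (A * B) = d" "dim_col (B * A) = dim_row B"
    using A B by (simp_all add: inverts_mat_def)
  then have Bc: "B \<in> carrier_mat d d" using A by auto
  show "int_mat_inv (int_mat_inv A) = A"
    unfolding eq by (rule int_mat_inv_eqI[OF Bc B(2,1)])
  show "int_mat_inv A \<in> GL_int d"
    using Bc A B by (auto simp: eq GL_int_def invertible_mat_def)
  show "int_mat_inv A \<in> carrier_mat d d" "A * int_mat_inv A = 1\<^sub>m d" "int_mat_inv A * A = 1\<^sub>m d"
    using A Bc B by (simp_all add: eq inverts_mat_def)
qed

lemma GL_intI:
  assumes "A \<in> carrier_mat d d" "B \<in> carrier_mat d d" "A * B = 1\<^sub>m d" "B * A = 1\<^sub>m d"
  shows "A \<in> GL_int d" "int_mat_inv A = B"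
  using assms int_mat_inv_eqI[OF assms(1), of B]
  by (auto simp: GL_int_def invertible_mat_def inverts_mat_def)

lemma mult_mat_vec_eq_iff_inverse:
  fixes A B :: "int mat"
  assumes "A \<in> carrier_mat d d" "B \<in> carrier_mat d d" "A * B = 1\<^sub>m d" "B * A = 1\<^sub>m d"
    and "v \<in> carrier_vec d" "w \<in> carrier_vec d"
  shows "v = B *\<^sub>v w \<longleftrightarrow> w = A *\<^sub>v v"
proof
  assume "v = B *\<^sub>v w"
  then have "A *\<^sub>v v = A * B *\<^sub>v w" using assoc_mult_mat_vec[OF assms(1,2,6)] by simp
  then show "w = A *\<^sub>v v" using assms by simp
next
  assume "w = A *\<^sub>v v"
  then have "B *\<^sub>v w = B * A *\<^sub>v v" using assoc_mult_mat_vec[OF assms(2,1,5)] by simp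
  then show "v = B *\<^sub>v w" using assms by simp
qed

lemma mem_supp_iff:
  "j \<in> supp \<theta> n \<longleftrightarrow> j \<in> lattice \<theta> \<and> (\<forall>r < rdim \<theta>. 0 \<le> j $ r \<and> j $ r < int (sides \<theta> ! r) ^ n)"
  by (auto simp: supp_def box_def supp_lo_def supp_hi_def)

lemma supp_subset_lattice: "j \<in> supp \<theta> n \<Longrightarrow> j \<in> lattice \<theta>"
  by (simp add: mem_supp_iff)

lemma centred_carrier [simp]: "centred \<theta> n j \<in> lattice \<theta>"
  by (simp add: centred_def)

lemma centred_inj:
  "i \<in> lattice \<theta> \<Longrightarrow> j \<in> lattice \<theta> \<Longrightarrow> centred \<theta> n i = centred \<theta> n j \<longleftrightarrow> i = j"
  by (auto simp: centred_def vec_eq_iff)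

text \<open>
  In centred coordinates \<^const>\<open>odot\<close> is plain multiplication by the matrix.
\<close>

lemma odot_supp_eq_iff:
  assumes A: "A \<in> carrier_mat (rdim \<theta>) (rdim \<theta>)" and i: "i \<in> lattice \<theta>" and j: "j \<in> lattice \<theta>"
  shows "map_vec rat_of_int j = odot_supp \<theta> n A i \<longleftrightarrow> centred \<theta> n j = A *\<^sub>v centred \<theta> n i"
proof -
  let ?d = "rdim \<theta>"
  define h where "h r = (rat_of_int (int (sides \<theta> ! r) ^ n) - 1) / 2" for r
  define k where "k = box_shift (supp_lo \<theta>) (supp_hi \<theta> n)"
  define A' where "A' = map_mat rat_of_int A"
  have k: "k \<in> carrier_vec ?d" "\<And>r. r < ?d \<Longrightarrow> k $ r = - h r"
    by (auto simp: k_def box_shift_def supp_lo_def supp_hi_def h_def)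
  have A': "A' \<in> carrier_mat ?d ?d" "\<And>r c. r < ?d \<Longrightarrow> c < ?d \<Longrightarrow> A' $$ (r, c) = rat_of_int (A $$ (r, c))"
    using A by (auto simp: A'_def)
  have odot: "odot_supp \<theta> n A i = A' *\<^sub>v map_vec rat_of_int i + A' *\<^sub>v k - k"
    by (simp add: odot_def Let_def k_def A'_def)
  have "odot_supp \<theta> n A i $ r = (\<Sum>c<?d. of_int (A $$ (r, c)) * (of_int (i $ c) - h c)) + h r"
    if r: "r < ?d" for r
  proof -
    have "odot_supp \<theta> n A i $ r = (A' *\<^sub>v map_vec rat_of_int i) $ r + (A' *\<^sub>v k) $ r - k $ r"
      unfolding odot using r A'(1) k(1) i by simp
    also have "\<dots> = (\<Sum>c<?d. of_int (A $$ (r, c)) * of_int (i $ c)) + (\<Sum>c<?d. of_int (A $$ (r, c)) * - h c) + h r"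
      using r i A' k by (simp add: mult_mat_vec_index[of _ ?d] del: index_mult_mat_vec)
    finally show ?thesis by (simp add: right_diff_distrib sum_subtractf sum_negf)
  qed
  note odot_index = this
  have "dim_vec (odot_supp \<theta> n A i) = ?d" using k(1) by (simp add: odot)
  then have "map_vec rat_of_int j = odot_supp \<theta> n A i \<longleftrightarrow>
      (\<forall>r<?d. of_int (j $ r) = (\<Sum>c<?d. of_int (A $$ (r, c)) * (of_int (i $ c) - h c)) + h r)"
    using j odot_index by (auto simp: vec_eq_iff)
  also have "\<dots> \<longleftrightarrow> (\<forall>r<?d. centred \<theta> n j $ r = (A *\<^sub>v centred \<theta> n i) $ r)"
  proof (rule all_cong)
    fix r assume r: "r < ?d"
    have "(A *\<^sub>v centred \<theta> n i) $ r = (\<Sum>c<?d. A $$ (r, c) * centred \<theta> n i $ c)"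
      using mult_mat_vec_index[OF A centred_carrier r] .
    then have "rat_of_int ((A *\<^sub>v centred \<theta> n i) $ r) =
        (\<Sum>c<?d. of_int (A $$ (r, c)) * of_int (centred \<theta> n i $ c))"
      by (simp only: of_int_sum of_int_mult)
    also have "\<dots> = (\<Sum>c<?d. of_int (A $$ (r, c)) * (2 * (of_int (i $ c) - h c)))"
      by (rule sum.cong) (simp_all add: centred_def h_def field_simps)
    also have "\<dots> = 2 * (\<Sum>c<?d. of_int (A $$ (r, c)) * (of_int (i $ c) - h c))"
      by (simp add: sum_distrib_left algebra_simps)
    finally have 1: "rat_of_int ((A *\<^sub>v centred \<theta> n i) $ r) =
        2 * (\<Sum>c<?d. of_int (A $$ (r, c)) * (of_int (i $ c) - h c))" .
    have 2: "rat_of_int (centred \<theta> n j $ r) = 2 * (of_int (j $ r) - h r)"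
      using r by (simp add: centred_def h_def field_simps)
    have 3: "x = y + h r \<longleftrightarrow> 2 * (x - h r) = 2 * y" for x y by auto
    have "centred \<theta> n j $ r = (A *\<^sub>v centred \<theta> n i) $ r \<longleftrightarrow>
        rat_of_int (centred \<theta> n j $ r) = rat_of_int ((A *\<^sub>v centred \<theta> n i) $ r)"
      by (simp only: of_int_eq_iff)
    then show "of_int (j $ r) = (\<Sum>c<?d. of_int (A $$ (r, c)) * (of_int (i $ c) - h c)) + h r \<longleftrightarrow>
        centred \<theta> n j $ r = (A *\<^sub>v centred \<theta> n i) $ r"
      unfolding 1 2 3 by (rule sym)
  qed
  also have "\<dots> \<longleftrightarrow> centred \<theta> n j = A *\<^sub>v centred \<theta> n i"
    using A by (auto simp: vec_eq_iff centred_def)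
  finally show ?thesis .
qed

lemma sides_ge_2: "block_substitution \<theta> \<Longrightarrow> r < rdim \<theta> \<Longrightarrow> 2 \<le> sides \<theta> ! r"
  unfolding block_substitution_def using nth_mem by blast

text \<open>
  The bound comes from the corner of the box whose coordinates have the signs of the entries of the row.
\<close>

lemma row_sum_le:
  assumes \<theta>: "block_substitution \<theta>" and A: "A \<in> carrier_mat (rdim \<theta>) (rdim \<theta>)"
    and box: "\<And>i. i \<in> supp \<theta> 1 \<Longrightarrow> \<exists>j \<in> supp \<theta> 1. centred \<theta> 1 j = A *\<^sub>v centred \<theta> 1 i"
    and r: "r < rdim \<theta>"
  shows "(\<Sum>c<rdim \<theta>. \<bar>A $$ (r, c)\<bar> * (int (sides \<theta> ! c) - 1)) \<le> int (sides \<theta> ! r) - 1"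
proof -
  let ?d = "rdim \<theta>"
  have pos: "int (sides \<theta> ! c) > 0" if "c < ?d" for c
    using sides_ge_2[OF \<theta> that] by simp
  define i where "i = vec ?d (\<lambda>c. if A $$ (r, c) \<ge> 0 then int (sides \<theta> ! c) - 1 else 0)"
  have "i \<in> supp \<theta> 1" using pos by (auto simp: mem_supp_iff i_def)
  then obtain j where j: "j \<in> supp \<theta> 1" "centred \<theta> 1 j = A *\<^sub>v centred \<theta> 1 i"
    using box by blast
  have "(\<Sum>c<?d. \<bar>A $$ (r, c)\<bar> * (int (sides \<theta> ! c) - 1)) = (\<Sum>c<?d. A $$ (r, c) * centred \<theta> 1 i $ c)"
    by (rule sum.cong) (auto simp: centred_def i_def abs_if algebra_simps)
  also have "\<dots> = centred \<theta> 1 j $ r"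
    unfolding j(2) mult_mat_vec_index[OF A centred_carrier r] ..
  also have "\<dots> \<le> int (sides \<theta> ! r) - 1"
    using j(1) r by (auto simp: centred_def mem_supp_iff)
  finally show ?thesis .
qed

text \<open>
  Choose \<open>\<pi> r\<close> with \<open>A\<^bsub>r, \<pi> r\<^esub> \<noteq> 0\<close> and \<open>B\<^bsub>\<pi> r, r\<^esub> \<noteq> 0\<close>, which is possible because the diagonal entry of
  \<open>A B\<close> is not \<open>0\<close>. The row sums of \<open>A\<close> and \<open>B\<close> give \<open>h\<^bsub>\<pi> r\<^esub> \<le> h\<^sub>r\<close> and \<open>h\<^sub>r \<le> h\<^bsub>\<pi> r\<^esub>\<close>. So the single term
  \<open>c = \<pi> r\<close> exhausts the bound on row \<open>r\<close> of \<open>A\<close>. In the same way, \<open>\<pi> r = \<pi> r'\<close> with \<open>r \<noteq> r'\<close> would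
  exceed the bound on row \<open>\<pi> r\<close> of \<open>B\<close>.
\<close>

lemma box_preserving_imp_signed_perm:
  assumes \<theta>: "block_substitution \<theta>"
    and A: "A \<in> carrier_mat (rdim \<theta>) (rdim \<theta>)" and B: "B \<in> carrier_mat (rdim \<theta>) (rdim \<theta>)"
    and AB: "A * B = 1\<^sub>m (rdim \<theta>)"
    and boxA: "\<And>i. i \<in> supp \<theta> 1 \<Longrightarrow> \<exists>j \<in> supp \<theta> 1. centred \<theta> 1 j = A *\<^sub>v centred \<theta> 1 i"
    and boxB: "\<And>i. i \<in> supp \<theta> 1 \<Longrightarrow> \<exists>j \<in> supp \<theta> 1. centred \<theta> 1 j = B *\<^sub>v centred \<theta> 1 i"
  obtains \<pi> s where "side_perm \<theta> \<pi>" "A = signed_perm_mat (rdim \<theta>) \<pi> s"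
proof -
  let ?d = "rdim \<theta>"
  define h where "h r = int (sides \<theta> ! r) - 1" for r
  have pos: "h c > 0" if "c < ?d" for c
    using sides_ge_2[OF \<theta> that] by (simp add: h_def)
  have sumA: "(\<Sum>c<?d. \<bar>A $$ (r, c)\<bar> * h c) \<le> h r" if "r < ?d" for r
    using row_sum_le[OF \<theta> A boxA that] by (simp add: h_def)
  have sumB: "(\<Sum>c<?d. \<bar>B $$ (r, c)\<bar> * h c) \<le> h r" if "r < ?d" for r
    using row_sum_le[OF \<theta> B boxB that] by (simp add: h_def)
  have "\<exists>c<?d. A $$ (r, c) \<noteq> 0 \<and> B $$ (c, r) \<noteq> 0" if r: "r < ?d" for r
  proof (rule ccontr)
    assume contra: "\<not> ?thesis"
    have "(A * B) $$ (r, r) = (\<Sum>c<?d. A $$ (r, c) * B $$ (c, r))"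
      using r A B by (simp add: scalar_prod_def atLeast0LessThan)
    also have "\<dots> = 0" using contra by (intro sum.neutral) auto
    finally show False using AB r by simp
  qed
  then obtain \<pi> where \<pi>: "\<And>r. r < ?d \<Longrightarrow> \<pi> r < ?d \<and> A $$ (r, \<pi> r) \<noteq> 0 \<and> B $$ (\<pi> r, r) \<noteq> 0"
    by metis
  have mem: "x * h c \<le> (\<Sum>c<?d. \<bar>C c\<bar> * h c)" if "c < ?d" "x \<le> \<bar>C c\<bar>" for c x and C :: "nat \<Rightarrow> int"
  proof -
    have "x * h c \<le> \<bar>C c\<bar> * h c" using that pos[of c] by (intro mult_right_mono) auto
    also have "\<dots> \<le> (\<Sum>c<?d. \<bar>C c\<bar> * h c)"
      using that pos by (intro member_le_sum) (auto intro!: mult_nonneg_nonneg simp: less_imp_le)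
    finally show ?thesis .
  qed
  have mem2: "x * h c + y * h c' \<le> (\<Sum>c<?d. \<bar>C c\<bar> * h c)"
    if "c < ?d" "c' < ?d" "c \<noteq> c'" "x \<le> \<bar>C c\<bar>" "y \<le> \<bar>C c'\<bar>" for c c' x y and C :: "nat \<Rightarrow> int"
  proof -
    have "x * h c + y * h c' \<le> \<bar>C c\<bar> * h c + \<bar>C c'\<bar> * h c'"
      using that pos[of c] pos[of c'] by (intro add_mono mult_right_mono) auto
    also have "\<dots> = (\<Sum>c\<in>{c, c'}. \<bar>C c\<bar> * h c)" using that by simp
    also have "\<dots> \<le> (\<Sum>c<?d. \<bar>C c\<bar> * h c)"
      using that pos by (intro sum_mono2) (auto intro!: mult_nonneg_nonneg simp: less_imp_le)
    finally show ?thesis .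
  qed
  have same_h: "h (\<pi> r) = h r" if r: "r < ?d" for r
  proof (rule antisym)
    have "1 * h (\<pi> r) \<le> h r"
      using \<pi>[OF r] by (intro order.trans[OF mem sumA[OF r]]) auto
    then show "h (\<pi> r) \<le> h r" by simp
    have "1 * h r \<le> h (\<pi> r)"
      using \<pi>[OF r] r by (intro order.trans[OF mem sumB[of "\<pi> r"]]) auto
    then show "h r \<le> h (\<pi> r)" by simp
  qed
  have entry: "\<bar>A $$ (r, \<pi> r)\<bar> = 1" if r: "r < ?d" for r
  proof -
    have "\<bar>A $$ (r, \<pi> r)\<bar> * h (\<pi> r) \<le> h r"
      using \<pi>[OF r] by (intro order.trans[OF mem sumA[OF r]]) auto
    then have "\<bar>A $$ (r, \<pi> r)\<bar> \<le> 1"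
      using same_h[OF r] pos[OF r] by (metis mult_le_cancel_right1 mult_cancel_right1 not_less order.strict_iff_order)
    then show ?thesis using \<pi>[OF r] by linarith
  qed
  have zero: "A $$ (r, c) = 0" if r: "r < ?d" and c: "c < ?d" "c \<noteq> \<pi> r" for r c
  proof (rule ccontr)
    assume nz: "A $$ (r, c) \<noteq> 0"
    \<comment> \<open>A second nonzero entry would make the row sum exceed \<open>h r\<close>.\<close>
    have "1 * h (\<pi> r) + 1 * h c \<le> h r"
      using \<pi>[OF r] c nz by (intro order.trans[OF mem2 sumA[OF r]]) auto
    then show False using same_h[OF r] pos[OF c(1)] by simp
  qed
  have "inj_on \<pi> {..<?d}"
  proof (rule inj_onI, rule ccontr)
    fix r r' assume rr: "r \<in> {..<?d}" "r' \<in> {..<?d}" "\<pi> r = \<pi> r'" "r \<noteq> r'"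
    have "1 * h r + 1 * h r' \<le> h (\<pi> r)"
      using \<pi>[of r] \<pi>[of r'] rr by (intro order.trans[OF mem2 sumB[of "\<pi> r"]]) auto
    then show False using same_h[of r] pos[of r'] rr by simp
  qed
  moreover have "\<pi> ` {..<?d} \<subseteq> {..<?d}" using \<pi> by auto
  ultimately have "bij_betw \<pi> {..<?d} {..<?d}"
    by (simp add: bij_betw_def endo_inj_surj)
  then have "side_perm \<theta> \<pi>" using same_h by (auto simp: side_perm_def h_def)
  moreover have "A = signed_perm_mat ?d \<pi> (\<lambda>r. A $$ (r, \<pi> r) > 0)"
  proof (rule eq_matI)
    fix r c assume "r < dim_row (signed_perm_mat ?d \<pi> (\<lambda>r. A $$ (r, \<pi> r) > 0))"
      "c < dim_col (signed_perm_mat ?d \<pi> (\<lambda>r. A $$ (r, \<pi> r) > 0))"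
    then have "r < ?d" "c < ?d" by (simp_all add: signed_perm_mat_def)
    then show "A $$ (r, c) = signed_perm_mat ?d \<pi> (\<lambda>r. A $$ (r, \<pi> r) > 0) $$ (r, c)"
      using entry[of r] zero[of r c] by (auto simp: signed_perm_mat_def abs_if split: if_splits)
  qed (use A in \<open>simp_all add: signed_perm_mat_def\<close>)
  ultimately show thesis by (rule that)
qed

lemma reposition_carrier [simp]: "reposition \<theta> \<pi> s n j \<in> lattice \<theta>"
  by (simp add: reposition_def)

lemma side_permD:
  assumes "side_perm \<theta> \<pi>" "r < rdim \<theta>"
  shows "\<pi> r < rdim \<theta>" "sides \<theta> ! \<pi> r = sides \<theta> ! r"
proof -
  have "\<pi> r \<in> {..<rdim \<theta>}"
    using assms unfolding side_perm_def by (intro bij_betw_apply[of \<pi> "{..<rdim \<theta>}"]) simp_all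
  then show "\<pi> r < rdim \<theta>" by simp
  show "sides \<theta> ! \<pi> r = sides \<theta> ! r" using assms unfolding side_perm_def by blast
qed

lemma centred_reposition:
  assumes "side_perm \<theta> \<pi>" "j \<in> lattice \<theta>"
  shows "centred \<theta> n (reposition \<theta> \<pi> s n j) = signed_perm_mat (rdim \<theta>) \<pi> s *\<^sub>v centred \<theta> n j"
proof (rule eq_vecI)
  fix r assume "r < dim_vec (signed_perm_mat (rdim \<theta>) \<pi> s *\<^sub>v centred \<theta> n j)"
  then have r: "r < rdim \<theta>" by (simp add: signed_perm_mat_def)
  note \<pi> = side_permD[OF assms(1) r]
  show "centred \<theta> n (reposition \<theta> \<pi> s n j) $ r = (signed_perm_mat (rdim \<theta>) \<pi> s *\<^sub>v centred \<theta> n j) $ r"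
    unfolding signed_perm_mat_mult_vec[of "centred \<theta> n j" "rdim \<theta>" r \<pi>, OF centred_carrier r \<pi>(1)]
    by (simp add: centred_def reposition_def r \<pi>)
qed (simp add: centred_def signed_perm_mat_def)

text \<open>
  Replacing \<open>j = A\<^sup>-\<^sup>1 \<odot> i\<close> by \<open>i = A \<odot> j\<close> avoids the inverse matrix from here on.
\<close>

lemma odot_inverse_eq_reposition:
  assumes "side_perm \<theta> \<pi>" "i \<in> lattice \<theta>" "j \<in> lattice \<theta>"
  shows "map_vec rat_of_int j = odot_supp \<theta> n (int_mat_inv (signed_perm_mat (rdim \<theta>) \<pi> s)) i
    \<longleftrightarrow> i = reposition \<theta> \<pi> s n j"
proof -
  let ?A = "signed_perm_mat (rdim \<theta>) \<pi> s"
  obtain B where B: "B \<in> carrier_mat (rdim \<theta>) (rdim \<theta>)" "?A * B = 1\<^sub>m (rdim \<theta>)" "B * ?A = 1\<^sub>m (rdim \<theta>)"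
    using signed_perm_mat_inverse assms(1) unfolding side_perm_def by metis
  have inv: "int_mat_inv ?A = B" using GL_intI(2)[OF signed_perm_mat_carrier B] .
  have "map_vec rat_of_int j = odot_supp \<theta> n B i \<longleftrightarrow> centred \<theta> n j = B *\<^sub>v centred \<theta> n i"
    using odot_supp_eq_iff[OF B(1) assms(2,3)] .
  also have "\<dots> \<longleftrightarrow> centred \<theta> n i = ?A *\<^sub>v centred \<theta> n j"
    by (rule mult_mat_vec_eq_iff_inverse[OF _ B(1)]) (simp_all add: B)
  also have "\<dots> \<longleftrightarrow> i = reposition \<theta> \<pi> s n j"
    using assms by (simp add: centred_reposition[symmetric] centred_inj)
  finally show ?thesis by (simp only: inv)
qed

lemma finite_supp: "finite (supp \<theta> n)"
proof (rule finite_surj)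
  let ?F = "PiE {..<rdim \<theta>} (\<lambda>r. {0..<int (sides \<theta> ! r) ^ n})"
  show "finite ?F" by (simp add: finite_PiE)
  show "supp \<theta> n \<subseteq> vec (rdim \<theta>) ` ?F"
  proof
    fix j assume "j \<in> supp \<theta> n"
    then have j: "j \<in> lattice \<theta>" "\<And>r. r < rdim \<theta> \<Longrightarrow> 0 \<le> j $ r \<and> j $ r < int (sides \<theta> ! r) ^ n"
      by (simp_all add: mem_supp_iff)
    have "j = vec (rdim \<theta>) (\<lambda>r\<in>{..<rdim \<theta>}. j $ r)"
      by (rule eq_vecI) (use j(1) in simp_all)
    moreover have "(\<lambda>r\<in>{..<rdim \<theta>}. j $ r) \<in> ?F" using j(2) by auto
    ultimately show "j \<in> vec (rdim \<theta>) ` ?F" by blast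
  qed
qed

lemma reposition_supp_bij:
  assumes "side_perm \<theta> \<pi>"
  shows "bij_betw (reposition \<theta> \<pi> s n) (supp \<theta> n) (supp \<theta> n)"
proof -
  note \<pi> = side_permD[OF assms]
  have "reposition \<theta> \<pi> s n j \<in> supp \<theta> n" if "j \<in> supp \<theta> n" for j
    unfolding mem_supp_iff
  proof (intro conjI allI impI)
    fix r assume r: "r < rdim \<theta>"
    have "0 \<le> j $ \<pi> r" "j $ \<pi> r < int (sides \<theta> ! r) ^ n"
      using that \<pi>[OF r] by (auto simp: mem_supp_iff)
    then show "0 \<le> reposition \<theta> \<pi> s n j $ r" "reposition \<theta> \<pi> s n j $ r < int (sides \<theta> ! r) ^ n"
      using r by (auto simp: reposition_def)
  qed simp
  moreover have "inj_on (reposition \<theta> \<pi> s n) (supp \<theta> n)"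
  proof (rule inj_onI)
    fix i j assume ij: "i \<in> supp \<theta> n" "j \<in> supp \<theta> n" "reposition \<theta> \<pi> s n i = reposition \<theta> \<pi> s n j"
    then have ij': "i \<in> lattice \<theta>" "j \<in> lattice \<theta>" by (simp_all add: supp_subset_lattice)
    let ?M = "int_mat_inv (signed_perm_mat (rdim \<theta>) \<pi> s)"
    have "map_vec rat_of_int i = odot_supp \<theta> n ?M (reposition \<theta> \<pi> s n i)"
      "map_vec rat_of_int j = odot_supp \<theta> n ?M (reposition \<theta> \<pi> s n j)"
      using odot_inverse_eq_reposition[OF assms reposition_carrier] ij' by blast+
    with ij(3) have "map_vec rat_of_int i = map_vec rat_of_int j" by simp
    then show "i = j" using ij' by (auto simp: vec_eq_iff)
  qed
  ultimately show ?thesis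
    by (simp add: bij_betw_def endo_inj_surj finite_supp image_subsetI)
qed

text \<open>
  The condition that a shuffling pair has to satisfy at level \<open>n\<close>.
\<close>

definition columns_commute ::
    "'a block_subst \<Rightarrow> ('a \<Rightarrow> 'a) \<Rightarrow> (nat \<Rightarrow> nat) \<Rightarrow> (nat \<Rightarrow> bool) \<Rightarrow> nat \<Rightarrow> bool" where
  "columns_commute \<theta> \<tau> \<pi> s n \<longleftrightarrow> (\<forall>a \<in> alphabet \<theta>. \<forall>j \<in> supp \<theta> n.
     column \<theta> n (reposition \<theta> \<pi> s n j) (\<tau> a) = \<tau> (column \<theta> n j a))"

text \<open>
  One level of the boxes already determines the shape of \<open>A\<close>: level \<open>1\<close> is used for the forward direction.
\<close>

lemma supertile_shuffling_iff:
  assumes \<theta>: "block_substitution \<theta>"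
  shows "supertile_shuffling \<theta> \<tau> A \<longleftrightarrow> \<tau> permutes alphabet \<theta> \<and>
    (\<exists>\<pi> s. side_perm \<theta> \<pi> \<and> A = signed_perm_mat (rdim \<theta>) \<pi> s \<and>
      (\<exists>N. \<forall>n\<ge>N. columns_commute \<theta> \<tau> \<pi> s n))"
proof -
  have shuffle: "(\<exists>N. \<forall>a \<in> alphabet \<theta>. \<forall>n \<ge> N. \<forall>i \<in> supp \<theta> n. \<forall>j \<in> supp \<theta> n.
        map_vec rat_of_int j = odot_supp \<theta> n (int_mat_inv A) i \<longrightarrow>
        column \<theta> n i (\<tau> a) = \<tau> (column \<theta> n j a)) \<longleftrightarrow>
      (\<exists>N. \<forall>n\<ge>N. columns_commute \<theta> \<tau> \<pi> s n)"
    if "side_perm \<theta> \<pi>" "A = signed_perm_mat (rdim \<theta>) \<pi> s" for \<pi> s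
  proof -
    have eq: "map_vec rat_of_int j = odot_supp \<theta> n (int_mat_inv A) i \<longleftrightarrow> i = reposition \<theta> \<pi> s n j"
      if "i \<in> supp \<theta> n" "j \<in> supp \<theta> n" for i j n
      unfolding \<open>A = _\<close>
      by (rule odot_inverse_eq_reposition[OF \<open>side_perm \<theta> \<pi>\<close> that[THEN supp_subset_lattice]])
    have mem: "reposition \<theta> \<pi> s n j \<in> supp \<theta> n" if "j \<in> supp \<theta> n" for j n
      by (rule bij_betw_apply[OF reposition_supp_bij[OF \<open>side_perm \<theta> \<pi>\<close>] that])
    have "columns_commute \<theta> \<tau> \<pi> s n \<longleftrightarrow> (\<forall>a \<in> alphabet \<theta>. \<forall>i \<in> supp \<theta> n. \<forall>j \<in> supp \<theta> n.
        map_vec rat_of_int j = odot_supp \<theta> n (int_mat_inv A) i \<longrightarrow>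
        column \<theta> n i (\<tau> a) = \<tau> (column \<theta> n j a))" for n
      unfolding columns_commute_def using mem by (simp add: eq cong: ball_cong) blast
    then show ?thesis by blast
  qed
  show ?thesis
  proof (intro iffI conjI; (elim conjE exE)?)
    assume ss: "supertile_shuffling \<theta> \<tau> A"
    then show "\<tau> permutes alphabet \<theta>" by (simp add: supertile_shuffling_def)
    define B where "B = int_mat_inv A"
    have GL: "A \<in> GL_int (rdim \<theta>)" and
      img: "odot_supp \<theta> 1 B ` supp \<theta> 1 = map_vec rat_of_int ` supp \<theta> 1"
      using ss by (auto simp: supertile_shuffling_def B_def)
    have A: "A \<in> carrier_mat (rdim \<theta>) (rdim \<theta>)" using GL by (simp add: GL_int_def)
    have B: "B \<in> carrier_mat (rdim \<theta>) (rdim \<theta>)" and AB: "A * B = 1\<^sub>m (rdim \<theta>)" and BA: "B * A = 1\<^sub>m (rdim \<theta>)"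
      using GL_int_inverse[OF GL] by (simp_all add: B_def)
    have boxB: "\<exists>j \<in> supp \<theta> 1. centred \<theta> 1 j = B *\<^sub>v centred \<theta> 1 i" if "i \<in> supp \<theta> 1" for i
    proof -
      have "odot_supp \<theta> 1 B i \<in> map_vec rat_of_int ` supp \<theta> 1" using that img by blast
      then obtain j where "j \<in> supp \<theta> 1" "map_vec rat_of_int j = odot_supp \<theta> 1 B i" by auto
      then show ?thesis using odot_supp_eq_iff[OF B] that supp_subset_lattice by blast
    qed
    have boxA: "\<exists>j \<in> supp \<theta> 1. centred \<theta> 1 j = A *\<^sub>v centred \<theta> 1 i" if "i \<in> supp \<theta> 1" for i
    proof -
      have "map_vec rat_of_int i \<in> odot_supp \<theta> 1 B ` supp \<theta> 1" using that img by blast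
      then obtain j where j: "j \<in> supp \<theta> 1" "map_vec rat_of_int i = odot_supp \<theta> 1 B j" by auto
      then have "centred \<theta> 1 i = B *\<^sub>v centred \<theta> 1 j"
        using odot_supp_eq_iff[OF B] that supp_subset_lattice by blast
      then show ?thesis
        using mult_mat_vec_eq_iff_inverse[OF A B AB BA] j(1) centred_carrier by blast
    qed
    obtain \<pi> s where "side_perm \<theta> \<pi>" "A = signed_perm_mat (rdim \<theta>) \<pi> s"
      using box_preserving_imp_signed_perm[OF \<theta> A B AB boxA boxB] by blast
    moreover from this have "\<exists>N. \<forall>n\<ge>N. columns_commute \<theta> \<tau> \<pi> s n"
      using ss shuffle unfolding supertile_shuffling_def by blast
    ultimately show "\<exists>\<pi> s. side_perm \<theta> \<pi> \<and> A = signed_perm_mat (rdim \<theta>) \<pi> s \<and>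
        (\<exists>N. \<forall>n\<ge>N. columns_commute \<theta> \<tau> \<pi> s n)" by blast
  next
    fix \<pi> s N
    assume \<tau>: "\<tau> permutes alphabet \<theta>" and \<pi>: "side_perm \<theta> \<pi>" and A: "A = signed_perm_mat (rdim \<theta>) \<pi> s"
      and N: "\<forall>n\<ge>N. columns_commute \<theta> \<tau> \<pi> s n"
    obtain B where B: "B \<in> carrier_mat (rdim \<theta>) (rdim \<theta>)" "A * B = 1\<^sub>m (rdim \<theta>)" "B * A = 1\<^sub>m (rdim \<theta>)"
      using signed_perm_mat_inverse \<pi> unfolding side_perm_def A by metis
    have "A \<in> GL_int (rdim \<theta>)" by (rule GL_intI(1)[OF _ B]) (simp add: A)
    moreover have "odot_supp \<theta> n (int_mat_inv A) ` supp \<theta> n = map_vec rat_of_int ` supp \<theta> n" for n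
    proof -
      have eq: "odot_supp \<theta> n (int_mat_inv A) (reposition \<theta> \<pi> s n j) = map_vec rat_of_int j"
        if "j \<in> supp \<theta> n" for j
        using odot_inverse_eq_reposition[OF \<pi> reposition_carrier] that supp_subset_lattice A by metis
      have "odot_supp \<theta> n (int_mat_inv A) ` supp \<theta> n =
          odot_supp \<theta> n (int_mat_inv A) ` reposition \<theta> \<pi> s n ` supp \<theta> n"
        using reposition_supp_bij[OF \<pi>, of s n] by (simp add: bij_betw_def)
      also have "\<dots> = map_vec rat_of_int ` supp \<theta> n"
        unfolding image_image by (rule image_cong) (simp_all add: eq)
      finally show ?thesis .
    qed
    ultimately show "supertile_shuffling \<theta> \<tau> A"
      unfolding supertile_shuffling_def using \<tau> shuffle[OF \<pi> A] N by blast
  qed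
qed

section \<open>Columns of powers\<close>

text \<open>
  The position with the digits of \<open>v\<close> at the places below \<open>k\<close> and those of \<open>u\<close> from place \<open>k\<close> on, that is
  \<open>v + Q\<^sup>k u\<close>.
\<close>

definition glue :: "'a block_subst \<Rightarrow> nat \<Rightarrow> int vec \<Rightarrow> int vec \<Rightarrow> int vec" where
  "glue \<theta> k v u = vec (rdim \<theta>) (\<lambda>r. v $ r + int (sides \<theta> ! r) ^ k * u $ r)"

lemma glue_carrier [simp]: "glue \<theta> k v u \<in> lattice \<theta>"
  by (simp add: glue_def)

lemma glue_mem_supp:
  assumes "v \<in> supp \<theta> k" "u \<in> supp \<theta> n"
  shows "glue \<theta> k v u \<in> supp \<theta> (k + n)"
  unfolding mem_supp_iff
proof (intro conjI allI impI)
  fix r assume r: "r < rdim \<theta>"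
  let ?L = "int (sides \<theta> ! r)"
  have v: "0 \<le> v $ r" "v $ r < ?L ^ k" and u: "0 \<le> u $ r" "u $ r < ?L ^ n"
    using assms r by (auto simp: mem_supp_iff)
  show "0 \<le> glue \<theta> k v u $ r" using v u r by (simp add: glue_def)
  have "v $ r + ?L ^ k * u $ r < ?L ^ k * (u $ r + 1)" using v by (simp add: algebra_simps)
  also have "\<dots> \<le> ?L ^ k * ?L ^ n" using u by (intro mult_left_mono) auto
  finally show "glue \<theta> k v u $ r < ?L ^ (k + n)" using r by (simp add: glue_def power_add)
qed simp

lemma supp_add_cases:
  assumes \<theta>: "block_substitution \<theta>" and j: "j \<in> supp \<theta> (k + n)"
  obtains v u where "v \<in> supp \<theta> k" "u \<in> supp \<theta> n" "j = glue \<theta> k v u"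
proof
  define v where "v = vec (rdim \<theta>) (\<lambda>r. j $ r mod int (sides \<theta> ! r) ^ k)"
  define u where "u = vec (rdim \<theta>) (\<lambda>r. j $ r div int (sides \<theta> ! r) ^ k)"
  have pos: "int (sides \<theta> ! r) ^ k > 0" if "r < rdim \<theta>" for r
    using sides_ge_2[OF \<theta> that] by simp
  show "v \<in> supp \<theta> k" using pos by (simp add: mem_supp_iff v_def)
  show "u \<in> supp \<theta> n"
    unfolding mem_supp_iff
  proof (intro conjI allI impI)
    fix r assume r: "r < rdim \<theta>"
    let ?L = "int (sides \<theta> ! r)"
    have jr: "0 \<le> j $ r" "j $ r < ?L ^ n * ?L ^ k"
      using j r by (auto simp: mem_supp_iff power_add mult.commute)
    show "0 \<le> u $ r" using jr pos[OF r] r by (simp add: u_def pos_imp_zdiv_nonneg_iff)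
    have "u $ r * ?L ^ k \<le> j $ r"
      using pos_mod_sign[OF pos[OF r], of "j $ r"] minus_mod_eq_div_mult[of "j $ r" "?L ^ k"] r
      by (simp add: u_def)
    then have "u $ r * ?L ^ k < ?L ^ n * ?L ^ k" using jr(2) by linarith
    then show "u $ r < ?L ^ n" using pos[OF r] mult_less_cancel_right_pos by blast
  qed (simp add: u_def)
  show "j = glue \<theta> k v u"
    by (rule eq_vecI) (use j in \<open>simp_all add: glue_def v_def u_def mem_supp_iff\<close>)
qed

lemma digit_mem_supp: "block_substitution \<theta> \<Longrightarrow> digit \<theta> i j \<in> supp \<theta> 1"
  using sides_ge_2[of \<theta>] by (fastforce simp: mem_supp_iff digit_def)

lemma digit_glue_low:
  assumes "i < k"
  shows "digit \<theta> i (glue \<theta> k v u) = digit \<theta> i v"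
proof (rule eq_vecI)
  fix r assume "r < dim_vec (digit \<theta> i v)"
  then have r: "r < rdim \<theta>" by (simp add: digit_def)
  let ?L = "int (sides \<theta> ! r)"
  obtain e where e: "k = i + Suc e" using assms less_imp_Suc_add by fastforce
  have "(v $ r + ?L ^ k * u $ r) div ?L ^ i mod ?L = v $ r div ?L ^ i mod ?L"
  proof (cases "?L ^ i = 0")
    case True
    show ?thesis by (simp only: True div_by_0)
  next
    case False
    then have "(v $ r + ?L ^ k * u $ r) div ?L ^ i = v $ r div ?L ^ i + ?L * (?L ^ e * u $ r)"
      using div_mult_self2[OF False, of "v $ r" "?L * (?L ^ e * u $ r)"]
      by (simp add: e power_add algebra_simps)
    then show ?thesis by simp
  qed
  then show "digit \<theta> i (glue \<theta> k v u) $ r = digit \<theta> i v $ r" using r by (simp add: digit_def glue_def)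
qed (simp add: digit_def)

lemma digit_glue_high:
  assumes "v \<in> supp \<theta> k"
  shows "digit \<theta> (k + i) (glue \<theta> k v u) = digit \<theta> i u"
proof (rule eq_vecI)
  fix r assume "r < dim_vec (digit \<theta> i u)"
  then have r: "r < rdim \<theta>" by (simp add: digit_def)
  let ?L = "int (sides \<theta> ! r)"
  have v: "0 \<le> v $ r" "v $ r < ?L ^ k" using assms r by (auto simp: mem_supp_iff)
  have "(v $ r + ?L ^ k * u $ r) div ?L ^ (k + i) = (v $ r + ?L ^ k * u $ r) div ?L ^ k div ?L ^ i"
    using v by (simp add: power_add zdiv_zmult2_eq)
  also have "(v $ r + ?L ^ k * u $ r) div ?L ^ k = u $ r"
    using div_mult_self2[of "?L ^ k" "v $ r" "u $ r"] div_pos_pos_trivial[OF v] v by linarith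
  finally show "digit \<theta> (k + i) (glue \<theta> k v u) $ r = digit \<theta> i u $ r" using r by (simp add: digit_def glue_def)
qed (simp add: digit_def)

lemma column_0 [simp]: "column \<theta> 0 j a = a"
  by (simp add: column_def)

lemma column_1: "v \<in> supp \<theta> 1 \<Longrightarrow> column \<theta> 1 v a = rule \<theta> a v"
proof -
  assume "v \<in> supp \<theta> 1"
  then have "digit \<theta> 0 v = v" by (intro eq_vecI) (auto simp: digit_def mem_supp_iff)
  then show ?thesis by (simp add: column_def)
qed

text \<open>
  The low digits belong to the outer maps of the composition, so \<open>\<theta>\<^sup>n\<^bsub>u\<^esub>\<close> is applied first.
\<close>

lemma column_glue:
  assumes "v \<in> supp \<theta> k"
  shows "column \<theta> (k + n) (glue \<theta> k v u) a = column \<theta> k v (column \<theta> n u a)"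
proof -
  let ?F = "\<lambda>j i f. (\<lambda>a. rule \<theta> a (digit \<theta> i j)) \<circ> f"
  let ?g = "glue \<theta> k v u"
  have acc: "foldr (?F j) is f = foldr (?F j) is id \<circ> f" for j "is" f
    by (induction "is") (simp_all add: comp_assoc)
  have low: "foldr (?F ?g) [0..<k] id = column \<theta> k v"
    unfolding column_def by (rule foldr_cong) (simp_all add: digit_glue_low)
  have "foldr (?F ?g) (map ((+) k) is) id = foldr (?F u) is id" for "is"
    by (induction "is") (simp_all add: digit_glue_high[OF assms])
  moreover have "map ((+) k) [0..<n] = [k..<k + n]"
    by (rule nth_equalityI) simp_all
  ultimately have high: "foldr (?F ?g) [k..<k + n] id = column \<theta> n u"
    unfolding column_def by metis
  have "[0..<k + n] = [0..<k] @ [k..<k + n]" by (rule upt_add_eq_append) simp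
  then have "column \<theta> (k + n) ?g = foldr (?F ?g) [0..<k] (foldr (?F ?g) [k..<k + n] id)"
    by (simp add: column_def)
  also have "\<dots> = column \<theta> k v \<circ> column \<theta> n u"
    by (subst acc) (simp only: low high)
  finally show ?thesis by simp
qed

lemma column_mem_alphabet:
  assumes "block_substitution \<theta>" "a \<in> alphabet \<theta>"
  shows "column \<theta> n j a \<in> alphabet \<theta>"
proof -
  have "foldr (\<lambda>i f. (\<lambda>a. rule \<theta> a (digit \<theta> i j)) \<circ> f) is id a \<in> alphabet \<theta>" for "is"
    using assms digit_mem_supp[OF assms(1)] by (induction "is") (auto simp: block_substitution_def)
  then show ?thesis by (simp add: column_def)
qed

text \<open>
  Signed permutations act digitwise: a reflection of the large box is \<open>\<ell>\<^sup>k\<^sup>+\<^sup>n - 1 - (v + \<ell>\<^sup>k u) =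
  (\<ell>\<^sup>k - 1 - v) + \<ell>\<^sup>k (\<ell>\<^sup>n - 1 - u)\<close>.
\<close>

lemma reposition_glue:
  assumes "side_perm \<theta> \<pi>"
  shows "reposition \<theta> \<pi> s (k + n) (glue \<theta> k v u) = glue \<theta> k (reposition \<theta> \<pi> s k v) (reposition \<theta> \<pi> s n u)"
  by (rule eq_vecI)
    (simp_all add: reposition_def glue_def side_permD[OF assms] power_add algebra_simps)

section \<open>Deciding eventual commutation\<close>

definition letter_pairs ::
    "'a block_subst \<Rightarrow> ('a \<Rightarrow> 'a) \<Rightarrow> (nat \<Rightarrow> nat) \<Rightarrow> (nat \<Rightarrow> bool) \<Rightarrow> nat \<Rightarrow> ('a \<times> 'a) set" where
  "letter_pairs \<theta> \<tau> \<pi> s n =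
     (\<lambda>(a, j). (column \<theta> n (reposition \<theta> \<pi> s n j) (\<tau> a), column \<theta> n j a)) ` (alphabet \<theta> \<times> supp \<theta> n)"

definition pair_step ::
    "'a block_subst \<Rightarrow> (nat \<Rightarrow> nat) \<Rightarrow> (nat \<Rightarrow> bool) \<Rightarrow> ('a \<times> 'a) set \<Rightarrow> ('a \<times> 'a) set" where
  "pair_step \<theta> \<pi> s X =
     (\<lambda>((b, c), v). (rule \<theta> b (reposition \<theta> \<pi> s 1 v), rule \<theta> c v)) ` (X \<times> supp \<theta> 1)"

lemma pair_step_eq_UN: "pair_step \<theta> \<pi> s X =
  (\<Union>q \<in> X. \<Union>v \<in> supp \<theta> 1. {(rule \<theta> (fst q) (reposition \<theta> \<pi> s 1 v), rule \<theta> (snd q) v)})"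
  unfolding pair_step_def by force

lemma columns_commute_iff_pairs:
  "columns_commute \<theta> \<tau> \<pi> s n \<longleftrightarrow> (\<forall>p \<in> letter_pairs \<theta> \<tau> \<pi> s n. fst p = \<tau> (snd p))"
  by (auto simp: columns_commute_def letter_pairs_def)

lemma letter_pairs_0: "letter_pairs \<theta> \<tau> \<pi> s 0 = (\<lambda>a. (\<tau> a, a)) ` alphabet \<theta>"
proof -
  have "0\<^sub>v (rdim \<theta>) \<in> supp \<theta> 0" by (simp add: mem_supp_iff)
  then show ?thesis by (force simp: letter_pairs_def)
qed

text \<open>
  The lowest digit belongs to the outermost map of the composition, so it is the one split off here.
\<close>

lemma letter_pairs_Suc:
  assumes \<theta>: "block_substitution \<theta>" and \<pi>: "side_perm \<theta> \<pi>"
  shows "letter_pairs \<theta> \<tau> \<pi> s (Suc n) = pair_step \<theta> \<pi> s (letter_pairs \<theta> \<tau> \<pi> s n)"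
proof -
  have step: "(column \<theta> (Suc n) (reposition \<theta> \<pi> s (Suc n) (glue \<theta> 1 v u)) (\<tau> a), column \<theta> (Suc n) (glue \<theta> 1 v u) a)
      = (rule \<theta> (column \<theta> n (reposition \<theta> \<pi> s n u) (\<tau> a)) (reposition \<theta> \<pi> s 1 v), rule \<theta> (column \<theta> n u a) v)"
    if v: "v \<in> supp \<theta> 1" for v u a
  proof -
    have v': "reposition \<theta> \<pi> s 1 v \<in> supp \<theta> 1"
      by (rule bij_betw_apply[OF reposition_supp_bij[OF \<pi>] v])
    show ?thesis
      using column_glue[OF v, of n u a] column_glue[OF v', of n "reposition \<theta> \<pi> s n u" "\<tau> a"]
        reposition_glue[OF \<pi>, of s 1 n v u] column_1[OF v] column_1[OF v']
      by simp
  qed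
  show ?thesis
  proof (intro equalityI subsetI)
    fix p assume "p \<in> letter_pairs \<theta> \<tau> \<pi> s (Suc n)"
    then obtain a j where a: "a \<in> alphabet \<theta>" and j: "j \<in> supp \<theta> (1 + n)"
      and p: "p = (column \<theta> (Suc n) (reposition \<theta> \<pi> s (Suc n) j) (\<tau> a), column \<theta> (Suc n) j a)"
      by (auto simp: letter_pairs_def)
    obtain v u where v: "v \<in> supp \<theta> 1" and u: "u \<in> supp \<theta> n" and "j = glue \<theta> 1 v u"
      using supp_add_cases[OF \<theta> j] .
    with p step have p: "p = (rule \<theta> (column \<theta> n (reposition \<theta> \<pi> s n u) (\<tau> a)) (reposition \<theta> \<pi> s 1 v),
        rule \<theta> (column \<theta> n u a) v)" by simp
    have "(column \<theta> n (reposition \<theta> \<pi> s n u) (\<tau> a), column \<theta> n u a) \<in> letter_pairs \<theta> \<tau> \<pi> s n"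
      using a u by (force simp: letter_pairs_def)
    then show "p \<in> pair_step \<theta> \<pi> s (letter_pairs \<theta> \<tau> \<pi> s n)"
      using v unfolding p pair_step_def by force
  next
    fix p assume "p \<in> pair_step \<theta> \<pi> s (letter_pairs \<theta> \<tau> \<pi> s n)"
    then obtain a u v where a: "a \<in> alphabet \<theta>" and u: "u \<in> supp \<theta> n" and v: "v \<in> supp \<theta> 1"
      and p: "p = (rule \<theta> (column \<theta> n (reposition \<theta> \<pi> s n u) (\<tau> a)) (reposition \<theta> \<pi> s 1 v),
        rule \<theta> (column \<theta> n u a) v)"
      by (auto simp: letter_pairs_def pair_step_def)
    have "glue \<theta> 1 v u \<in> supp \<theta> (Suc n)" using glue_mem_supp[OF v u] by simp
    then show "p \<in> letter_pairs \<theta> \<tau> \<pi> s (Suc n)"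
      using a unfolding p step[OF v, symmetric] letter_pairs_def by force
  qed
qed

text \<open>
  Among \<open>X 0, \<dots>, X B\<close> two values agree, so \<open>X\<close> has a period \<open>p \<le> B\<close> from some index \<open>\<le> B\<close> on. Every value
  beyond the window is then also taken in the window, and every value in the window is taken
  arbitrarily late.
\<close>

lemma eventually_iff_window:
  assumes step: "\<And>n. X (Suc n) = F (X n)" and U: "\<And>n. X n \<in> U" "finite U" "card U \<le> B"
  shows "(\<exists>N. \<forall>n\<ge>N. P (X n)) \<longleftrightarrow> (\<forall>n\<in>{B..2 * B}. P (X n))"
proof -
  have "\<not> inj_on X {..B}"
  proof
    assume "inj_on X {..B}"
    then have "card {..B} \<le> card U" using U by (intro card_inj_on_le) auto
    then show False using U by simp
  qed
  then obtain i j where ij: "i < j" "j \<le> B" "X i = X j"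
    unfolding inj_on_def by (metis atMost_iff linorder_neqE_nat)
  define p where "p = j - i"
  have p: "p > 0" "p \<le> B" using ij by (auto simp: p_def)
  have period: "X (n + p) = X n" if "n \<ge> i" for n
    using that
  proof (induction n rule: dec_induct)
    case base
    show ?case using ij by (simp add: p_def)
  qed (simp add: step)
  \<comment> \<open>Shifting by \<open>N * p\<close> moves an index of the window beyond \<open>N\<close>.\<close>
  have multiple: "X (n + q * p) = X n" if "n \<ge> i" for n q
  proof (induction q)
    case (Suc q)
    then show ?case using period[of "n + q * p"] that by (simp add: algebra_simps)
  qed simp
  show ?thesis
  proof
    assume "\<exists>N. \<forall>n\<ge>N. P (X n)"
    then obtain N where N: "\<And>n. n \<ge> N \<Longrightarrow> P (X n)" by blast
    show "\<forall>n\<in>{B..2 * B}. P (X n)"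
    proof
      fix n assume "n \<in> {B..2 * B}"
      then have "X (n + N * p) = X n" using ij by (intro multiple) auto
      moreover have "N \<le> n + N * p" using p by (cases p) auto
      ultimately show "P (X n)" using N by metis
    qed
  next
    assume window: "\<forall>n\<in>{B..2 * B}. P (X n)"
    have "P (X n)" if "n \<ge> B" for n
      using that
    proof (induction n rule: less_induct)
      case (less n)
      show ?case
      proof (cases "n \<le> 2 * B")
        case True
        then show ?thesis using window less.prems by simp
      next
        case False
        then have "P (X (n - p))" using p by (intro less.IH) auto
        moreover have "X (n - p + p) = X (n - p)" using False p ij by (intro period) auto
        ultimately show ?thesis using False p by simp
      qed
    qed
    then show "\<exists>N. \<forall>n\<ge>N. P (X n)" by blast
  qed
qed

lemma eventually_commuting_iff:
  assumes \<theta>: "block_substitution \<theta>" and \<pi>: "side_perm \<theta> \<pi>" and \<tau>: "\<tau> permutes alphabet \<theta>"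
  defines "B \<equiv> 2 ^ (card (alphabet \<theta>) * card (alphabet \<theta>))"
  shows "(\<exists>N. \<forall>n\<ge>N. columns_commute \<theta> \<tau> \<pi> s n) \<longleftrightarrow> (\<forall>n\<in>{B..2 * B}. columns_commute \<theta> \<tau> \<pi> s n)"
  unfolding columns_commute_iff_pairs
proof (rule eventually_iff_window[where U = "Pow (alphabet \<theta> \<times> alphabet \<theta>)"])
  have fin: "finite (alphabet \<theta>)" using \<theta> by (simp add: block_substitution_def)
  then show "finite (Pow (alphabet \<theta> \<times> alphabet \<theta>))" by simp
  show "card (Pow (alphabet \<theta> \<times> alphabet \<theta>)) \<le> B"
    using fin by (simp add: B_def card_Pow card_cartesian_product)
  show "letter_pairs \<theta> \<tau> \<pi> s n \<in> Pow (alphabet \<theta> \<times> alphabet \<theta>)" for n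
    using \<tau> column_mem_alphabet[OF \<theta>] by (auto simp: letter_pairs_def permutes_in_image)
  show "letter_pairs \<theta> \<tau> \<pi> s (Suc n) = pair_step \<theta> \<pi> s (letter_pairs \<theta> \<tau> \<pi> s n)" for n
    by (rule letter_pairs_Suc[OF \<theta> \<pi>])
qed

section \<open>Shuffling pairs induce extended symmetries\<close>

text \<open>
  Primitivity is used to lift a pattern of a supertile of low level into one of high level.
\<close>

lemma letter_occurs_at_high_level:
  assumes \<theta>: "block_substitution \<theta>" and prim: "primitive \<theta>" and a: "a \<in> alphabet \<theta>"
  shows "\<exists>n\<ge>N. \<exists>b \<in> alphabet \<theta>. \<exists>u \<in> supp \<theta> n. column \<theta> n u b = a"
proof -
  obtain k where k: "\<And>a b. a \<in> alphabet \<theta> \<Longrightarrow> b \<in> alphabet \<theta> \<Longrightarrow> \<exists>j \<in> supp \<theta> k. column \<theta> k j a = b"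
    using prim unfolding primitive_def by blast
  have "\<exists>k\<ge>1. \<forall>b \<in> alphabet \<theta>. \<exists>c \<in> alphabet \<theta>. \<exists>j \<in> supp \<theta> k. column \<theta> k j c = b"
  proof (cases "k = 0")
    case True
    \<comment> \<open>The zeroth power is the identity, so there is only one letter.\<close>
    then have single: "b = c" if "b \<in> alphabet \<theta>" "c \<in> alphabet \<theta>" for b c
      using k[OF that] by simp
    have "digit \<theta> 0 (0\<^sub>v (rdim \<theta>)) \<in> supp \<theta> 1" by (rule digit_mem_supp[OF \<theta>])
    then have "\<forall>b \<in> alphabet \<theta>. \<exists>c \<in> alphabet \<theta>. \<exists>j \<in> supp \<theta> 1. column \<theta> 1 j c = b"
      using single column_mem_alphabet[OF \<theta>] by metis
    then show ?thesis by blast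
  next
    case False
    then show ?thesis using k by (intro exI[of _ k]) auto
  qed
  then obtain k where k: "k \<ge> 1"
    "\<And>b. b \<in> alphabet \<theta> \<Longrightarrow> \<exists>c \<in> alphabet \<theta>. \<exists>j \<in> supp \<theta> k. column \<theta> k j c = b" by blast
  show ?thesis
  proof (induction N)
    case 0
    have "0\<^sub>v (rdim \<theta>) \<in> supp \<theta> 0" by (simp add: mem_supp_iff)
    then show ?case using a by (intro exI[of _ 0]) auto
  next
    case (Suc N)
    then obtain n b u where n: "n \<ge> N" "b \<in> alphabet \<theta>" "u \<in> supp \<theta> n" "column \<theta> n u b = a" by blast
    obtain c j where c: "c \<in> alphabet \<theta>" "j \<in> supp \<theta> k" "column \<theta> k j c = b" using k(2)[OF n(2)] by blast
    have "column \<theta> (n + k) (glue \<theta> n u j) c = a" using column_glue[OF n(3)] c n by simp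
    moreover have "glue \<theta> n u j \<in> supp \<theta> (n + k)" by (rule glue_mem_supp[OF n(3) c(2)])
    moreover have "n + k \<ge> Suc N" using n(1) k(1) by simp
    ultimately show ?case using c(1) by blast
  qed
qed

lemma mem_subshift_iff:
  "x \<in> subshift \<theta> \<longleftrightarrow> x \<in> (\<Pi>\<^sub>E v \<in> lattice \<theta>. alphabet \<theta>) \<and>
     (\<forall>S. finite S \<and> S \<subseteq> lattice \<theta> \<longrightarrow> (\<exists>k. \<exists>a \<in> alphabet \<theta>. \<exists>t \<in> lattice \<theta>. \<forall>v \<in> S.
        v + t \<in> supp \<theta> k \<and> x v = column \<theta> k (v + t) a))"
proof -
  have "(\<lambda>v. Some (x v)) |` S \<in> language \<theta> \<longleftrightarrow> (\<exists>k. \<exists>a \<in> alphabet \<theta>. \<exists>t \<in> lattice \<theta>. \<forall>v \<in> S.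
        v + t \<in> supp \<theta> k \<and> x v = column \<theta> k (v + t) a)" if "finite S" "S \<subseteq> lattice \<theta>" for S
  proof -
    have "dom ((\<lambda>v. Some (x v)) |` S) = S" by (auto simp: restrict_map_def dom_def)
    then show ?thesis using that by (simp add: language_def restrict_map_def)
  qed
  then show ?thesis by (auto simp: subshift_def)
qed

lemma subshiftD: "x \<in> subshift \<theta> \<Longrightarrow> v \<in> lattice \<theta> \<Longrightarrow> x v \<in> alphabet \<theta>"
  by (auto simp: mem_subshift_iff)

lemma shift_mem_subshift:
  assumes x: "x \<in> subshift \<theta>" and n: "n \<in> lattice \<theta>"
  shows "shift \<theta> n x \<in> subshift \<theta>"
  unfolding mem_subshift_iff
proof (intro conjI allI impI)
  show "shift \<theta> n x \<in> (\<Pi>\<^sub>E v \<in> lattice \<theta>. alphabet \<theta>)"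
    using subshiftD[OF x] n by (auto simp: shift_def)
  fix S assume S: "finite S \<and> S \<subseteq> lattice \<theta>"
  then have "finite ((\<lambda>v. v + n) ` S)" "(\<lambda>v. v + n) ` S \<subseteq> lattice \<theta>" using n by auto
  then obtain k a t where kat: "a \<in> alphabet \<theta>" "t \<in> lattice \<theta>"
    "\<forall>v \<in> (\<lambda>v. v + n) ` S. v + t \<in> supp \<theta> k \<and> x v = column \<theta> k (v + t) a"
    using x unfolding mem_subshift_iff by meson
  have "v + (n + t) \<in> supp \<theta> k \<and> shift \<theta> n x v = column \<theta> k (v + (n + t)) a" if "v \<in> S" for v
  proof -
    have v: "v \<in> lattice \<theta>" using that S by blast
    have "v + n + t = v + (n + t)" by (rule assoc_add_vec[OF v n kat(2)])
    then show ?thesis using kat(3) that v by (auto simp: shift_def)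
  qed
  moreover have "n + t \<in> lattice \<theta>" using n kat by simp
  ultimately show "\<exists>k. \<exists>a \<in> alphabet \<theta>. \<exists>t \<in> lattice \<theta>. \<forall>v \<in> S.
      v + t \<in> supp \<theta> k \<and> shift \<theta> n x v = column \<theta> k (v + t) a"
    using kat(1) by blast
qed

text \<open>
  \<open>A \<odot> _\<close> is affine with linear part \<open>A\<close>, so translated patterns are moved to translated patterns.
\<close>

lemma reposition_add:
  assumes \<pi>: "side_perm \<theta> \<pi>" and v: "v \<in> lattice \<theta>" and t: "t \<in> lattice \<theta>"
  shows "reposition \<theta> \<pi> s n (v + t) = signed_perm_mat (rdim \<theta>) \<pi> s *\<^sub>v v + reposition \<theta> \<pi> s n t"
proof (rule eq_vecI)
  fix r assume "r < dim_vec (signed_perm_mat (rdim \<theta>) \<pi> s *\<^sub>v v + reposition \<theta> \<pi> s n t)"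
  then have r: "r < rdim \<theta>" by (simp add: reposition_def)
  have "(signed_perm_mat (rdim \<theta>) \<pi> s *\<^sub>v v + reposition \<theta> \<pi> s n t) $ r
      = (signed_perm_mat (rdim \<theta>) \<pi> s *\<^sub>v v) $ r + reposition \<theta> \<pi> s n t $ r"
    using r by (simp add: reposition_def)
  also have "\<dots> = reposition \<theta> \<pi> s n (v + t) $ r"
    unfolding signed_perm_mat_mult_vec[of v "rdim \<theta>" r \<pi>, OF v r side_permD(1)[OF \<pi> r]]
    using r side_permD[OF \<pi> r] v t by (simp add: reposition_def)
  finally show "reposition \<theta> \<pi> s n (v + t) $ r = (signed_perm_mat (rdim \<theta>) \<pi> s *\<^sub>v v + reposition \<theta> \<pi> s n t) $ r"
    by (rule sym)
qed (simp add: reposition_def)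

lemma induced_symmetry_apply:
  "x \<in> subshift \<theta> \<Longrightarrow> n \<in> lattice \<theta> \<Longrightarrow> induced_symmetry \<theta> \<tau> A x n = \<tau> (x (int_mat_inv A *\<^sub>v n))"
  by (simp add: induced_symmetry_def)

text \<open>
  A finite pattern of \<open>x\<close> lies in \<open>\<theta>\<^sup>k(a)\<close>, hence in \<open>\<theta>\<^sup>k\<^sup>+\<^sup>n(b)\<close> for some large \<open>n\<close>. There the commutation of
  columns turns the moved and relabelled pattern into a pattern of \<open>\<theta>\<^sup>k\<^sup>+\<^sup>n(\<tau> b)\<close>.
\<close>

lemma induced_symmetry_mem_subshift:
  assumes \<theta>: "block_substitution \<theta>" and prim: "primitive \<theta>"
    and ss: "supertile_shuffling \<theta> \<tau> A" and x: "x \<in> subshift \<theta>"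
  shows "induced_symmetry \<theta> \<tau> A x \<in> subshift \<theta>"
  unfolding mem_subshift_iff
proof (intro conjI allI impI)
  obtain \<pi> s N where \<tau>: "\<tau> permutes alphabet \<theta>" and \<pi>: "side_perm \<theta> \<pi>"
    and A: "A = signed_perm_mat (rdim \<theta>) \<pi> s"
    and N: "\<And>n. n \<ge> N \<Longrightarrow> columns_commute \<theta> \<tau> \<pi> s n"
    using ss unfolding supertile_shuffling_iff[OF \<theta>] by blast
  define M where "M = int_mat_inv A"
  have GL: "A \<in> GL_int (rdim \<theta>)" using ss by (simp add: supertile_shuffling_def)
  have Ac: "A \<in> carrier_mat (rdim \<theta>) (rdim \<theta>)" by (simp add: A)
  have M: "M \<in> carrier_mat (rdim \<theta>) (rdim \<theta>)" "A * M = 1\<^sub>m (rdim \<theta>)"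
    using GL_int_inverse[OF GL] by (simp_all add: M_def)
  have Mv: "M *\<^sub>v v \<in> lattice \<theta>" if "v \<in> lattice \<theta>" for v using M(1) that by simp
  have AMv: "A *\<^sub>v (M *\<^sub>v v) = v" if "v \<in> lattice \<theta>" for v
    using assoc_mult_mat_vec[OF Ac M(1) that] M(2) that by simp
  have \<tau>_alphabet: "\<tau> a \<in> alphabet \<theta>" if "a \<in> alphabet \<theta>" for a
    using \<tau> that by (simp add: permutes_in_image)
  show "induced_symmetry \<theta> \<tau> A x \<in> (\<Pi>\<^sub>E v \<in> lattice \<theta>. alphabet \<theta>)"
    using x subshiftD[OF x] Mv \<tau>_alphabet by (auto simp: induced_symmetry_def M_def[symmetric])
  fix S assume S: "finite S \<and> S \<subseteq> lattice \<theta>"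
  then have "finite ((*\<^sub>v) M ` S)" "(*\<^sub>v) M ` S \<subseteq> lattice \<theta>" using Mv by auto
  then obtain k a t where kat: "a \<in> alphabet \<theta>" "t \<in> lattice \<theta>"
    "\<forall>v \<in> (*\<^sub>v) M ` S. v + t \<in> supp \<theta> k \<and> x v = column \<theta> k (v + t) a"
    using x unfolding mem_subshift_iff by meson
  obtain n b u where n: "n \<ge> N" and b: "b \<in> alphabet \<theta>" and u: "u \<in> supp \<theta> n" "column \<theta> n u b = a"
    using letter_occurs_at_high_level[OF \<theta> prim kat(1)] by blast
  \<comment> \<open>If \<open>v + t\<close> is the place of a letter in \<open>\<theta>\<^sup>k(a)\<close>, then \<open>v + (t + Q\<^sup>k u)\<close> is its place in \<open>\<theta>\<^sup>k\<^sup>+\<^sup>n(b)\<close>;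
    \<open>t'\<close> is the image of this new translation.\<close>
  define t' where "t' = reposition \<theta> \<pi> s (k + n) (glue \<theta> k t u)"
  have "w + t' \<in> supp \<theta> (k + n) \<and> induced_symmetry \<theta> \<tau> A x w = column \<theta> (k + n) (w + t') (\<tau> b)"
    if "w \<in> S" for w
  proof -
    have w: "w \<in> lattice \<theta>" using that S by blast
    define v where "v = M *\<^sub>v w"
    have v: "v \<in> lattice \<theta>" using Mv[OF w] by (simp add: v_def)
    have vt: "v + t \<in> supp \<theta> k" "x v = column \<theta> k (v + t) a" using kat(3) that by (auto simp: v_def)
    have g: "glue \<theta> k (v + t) u = v + glue \<theta> k t u"
      by (rule eq_vecI) (use v kat(2) in \<open>simp_all add: glue_def\<close>)
    have j: "glue \<theta> k (v + t) u \<in> supp \<theta> (k + n)" by (rule glue_mem_supp[OF vt(1) u(1)])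
    have "reposition \<theta> \<pi> s (k + n) (v + glue \<theta> k t u) = A *\<^sub>v v + t'"
      unfolding A t'_def by (rule reposition_add[OF \<pi> v glue_carrier])
    then have r: "reposition \<theta> \<pi> s (k + n) (glue \<theta> k (v + t) u) = w + t'"
      using AMv[OF w] by (simp add: g flip: v_def)
    have "w + t' \<in> supp \<theta> (k + n)"
      using bij_betw_apply[OF reposition_supp_bij[OF \<pi>] j, of s] by (simp only: r)
    moreover have "column \<theta> (k + n) (reposition \<theta> \<pi> s (k + n) (glue \<theta> k (v + t) u)) (\<tau> b)
        = \<tau> (column \<theta> (k + n) (glue \<theta> k (v + t) u) b)"
      using N[of "k + n"] n b j by (simp add: columns_commute_def)
    then have "column \<theta> (k + n) (w + t') (\<tau> b) = \<tau> (x v)"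
      unfolding r column_glue[OF vt(1)] u(2) vt(2) .
    ultimately show ?thesis
      using induced_symmetry_apply[OF x w] by (simp add: v_def M_def)
  qed
  moreover have "t' \<in> lattice \<theta>" by (simp add: t'_def)
  ultimately show "\<exists>k. \<exists>a \<in> alphabet \<theta>. \<exists>t \<in> lattice \<theta>. \<forall>v \<in> S.
      v + t \<in> supp \<theta> k \<and> induced_symmetry \<theta> \<tau> A x v = column \<theta> k (v + t) a"
    using \<tau>_alphabet[OF b] by blast
qed

text \<open>
  \<open>j = A\<^sup>-\<^sup>1 \<odot> i\<close> and \<open>i = A \<odot> j\<close> are equivalent, so the condition is symmetric in the pair and its inverse.
\<close>

lemma supertile_shuffling_inverse:
  assumes ss: "supertile_shuffling \<theta> \<tau> A"
  shows "supertile_shuffling \<theta> (inv_into UNIV \<tau>) (int_mat_inv A)"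
proof -
  define M where "M = int_mat_inv A"
  have GL: "A \<in> GL_int (rdim \<theta>)" and \<tau>: "\<tau> permutes alphabet \<theta>"
    and img: "\<And>n. odot_supp \<theta> n M ` supp \<theta> n = map_vec rat_of_int ` supp \<theta> n"
    using ss by (auto simp: supertile_shuffling_def M_def)
  have A: "A \<in> carrier_mat (rdim \<theta>) (rdim \<theta>)" using GL by (simp add: GL_int_def)
  have M: "M \<in> GL_int (rdim \<theta>)" "M \<in> carrier_mat (rdim \<theta>) (rdim \<theta>)" "A * M = 1\<^sub>m (rdim \<theta>)"
    "M * A = 1\<^sub>m (rdim \<theta>)" "int_mat_inv M = A"
    using GL_int_inverse[OF GL] by (simp_all add: M_def)
  have swap: "map_vec rat_of_int j = odot_supp \<theta> n M i \<longleftrightarrow> map_vec rat_of_int i = odot_supp \<theta> n A j"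
    if "i \<in> supp \<theta> n" "j \<in> supp \<theta> n" for i j n
    unfolding odot_supp_eq_iff[OF M(2) that[THEN supp_subset_lattice]]
      odot_supp_eq_iff[OF A that(2,1)[THEN supp_subset_lattice]]
    by (rule mult_mat_vec_eq_iff_inverse[OF A M(2-4)]) simp_all
  have "odot_supp \<theta> n A ` supp \<theta> n = map_vec rat_of_int ` supp \<theta> n" for n
  proof (intro equalityI subsetI)
    fix q assume "q \<in> odot_supp \<theta> n A ` supp \<theta> n"
    then obtain j where j: "j \<in> supp \<theta> n" "q = odot_supp \<theta> n A j" by blast
    then have "map_vec rat_of_int j \<in> odot_supp \<theta> n M ` supp \<theta> n" using img by blast
    then obtain i where "i \<in> supp \<theta> n" "map_vec rat_of_int j = odot_supp \<theta> n M i" by blast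
    then have "q = map_vec rat_of_int i" "i \<in> supp \<theta> n" using swap[of i n j] j by simp_all
    then show "q \<in> map_vec rat_of_int ` supp \<theta> n" by blast
  next
    fix q assume "q \<in> map_vec rat_of_int ` supp \<theta> n"
    then obtain i where i: "i \<in> supp \<theta> n" "q = map_vec rat_of_int i" by blast
    then have "odot_supp \<theta> n M i \<in> map_vec rat_of_int ` supp \<theta> n" using img by blast
    then obtain j where "j \<in> supp \<theta> n" "map_vec rat_of_int j = odot_supp \<theta> n M i" by auto
    then show "q \<in> odot_supp \<theta> n A ` supp \<theta> n" using swap[of i n j] i by auto
  qed
  moreover obtain N where N: "\<And>a n i j. a \<in> alphabet \<theta> \<Longrightarrow> n \<ge> N \<Longrightarrow> i \<in> supp \<theta> n \<Longrightarrow> j \<in> supp \<theta> n \<Longrightarrow>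
      map_vec rat_of_int j = odot_supp \<theta> n M i \<Longrightarrow> column \<theta> n i (\<tau> a) = \<tau> (column \<theta> n j a)"
    using ss unfolding supertile_shuffling_def M_def by blast
  have "column \<theta> n i (inv_into UNIV \<tau> a) = inv_into UNIV \<tau> (column \<theta> n j a)"
    if "a \<in> alphabet \<theta>" "n \<ge> N" "i \<in> supp \<theta> n" "j \<in> supp \<theta> n" "map_vec rat_of_int j = odot_supp \<theta> n A i"
    for a n i j
  proof -
    have "inv_into UNIV \<tau> a \<in> alphabet \<theta>" using permutes_in_image[OF permutes_inv[OF \<tau>]] that(1) by blast
    then have "column \<theta> n j (\<tau> (inv_into UNIV \<tau> a)) = \<tau> (column \<theta> n i (inv_into UNIV \<tau> a))"
      using that swap[of j n i] by (intro N) auto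
    then show ?thesis using permutes_inverses[OF \<tau>] by metis
  qed
  ultimately show ?thesis
    unfolding supertile_shuffling_def M_def[symmetric] M(5)
    using permutes_inv[OF \<tau>] M(1) by blast
qed

lemma induced_symmetry_inverse:
  assumes \<theta>: "block_substitution \<theta>" and prim: "primitive \<theta>"
    and ss: "supertile_shuffling \<theta> \<tau> A" and x: "x \<in> subshift \<theta>"
  shows "induced_symmetry \<theta> (inv_into UNIV \<tau>) (int_mat_inv A) (induced_symmetry \<theta> \<tau> A x) = x"
proof
  fix n
  have GL: "A \<in> GL_int (rdim \<theta>)" and \<tau>: "\<tau> permutes alphabet \<theta>"
    using ss by (auto simp: supertile_shuffling_def)
  have A: "A \<in> carrier_mat (rdim \<theta>) (rdim \<theta>)" using GL by (simp add: GL_int_def)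
  note M = GL_int_inverse[OF GL]
  have \<Phi>x: "induced_symmetry \<theta> \<tau> A x \<in> subshift \<theta>"
    by (rule induced_symmetry_mem_subshift[OF \<theta> prim ss x])
  show "induced_symmetry \<theta> (inv_into UNIV \<tau>) (int_mat_inv A) (induced_symmetry \<theta> \<tau> A x) n = x n"
  proof (cases "n \<in> lattice \<theta>")
    case True
    then have An: "A *\<^sub>v n \<in> lattice \<theta>" using A by simp
    have "int_mat_inv A *\<^sub>v (A *\<^sub>v n) = n"
      using assoc_mult_mat_vec[OF M(2) A True] M(4) True by simp
    then show ?thesis
      using induced_symmetry_apply[OF \<Phi>x True] induced_symmetry_apply[OF x An] M(5)
        permutes_inverses[OF \<tau>] by simp
  next
    case False
    have "x n = undefined" using x False by (auto simp: mem_subshift_iff PiE_def extensional_def)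
    then show ?thesis using \<Phi>x False by (simp add: induced_symmetry_def)
  qed
qed

lemma topspace_subshift_topology [simp]: "topspace (subshift_topology \<theta>) = subshift \<theta>"
  by (auto simp: subshift_topology_def mem_subshift_iff)

lemma induced_symmetry_continuous:
  assumes \<theta>: "block_substitution \<theta>" and prim: "primitive \<theta>" and ss: "supertile_shuffling \<theta> \<tau> A"
  shows "continuous_map (subshift_topology \<theta>) (subshift_topology \<theta>) (induced_symmetry \<theta> \<tau> A)"
proof -
  have GL: "A \<in> GL_int (rdim \<theta>)" and \<tau>: "\<tau> permutes alphabet \<theta>"
    using ss by (auto simp: supertile_shuffling_def)
  note M = GL_int_inverse[OF GL]
  have mem: "induced_symmetry \<theta> \<tau> A x \<in> subshift \<theta>" if "x \<in> subshift \<theta>" for x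
    by (rule induced_symmetry_mem_subshift[OF \<theta> prim ss that])
  have "continuous_map (subshift_topology \<theta>) (discrete_topology (alphabet \<theta>)) (\<lambda>x. induced_symmetry \<theta> \<tau> A x n)"
    if n: "n \<in> lattice \<theta>" for n
  proof (rule continuous_map_eq)
    have "int_mat_inv A *\<^sub>v n \<in> lattice \<theta>" using M(2) n by simp
    then have "continuous_map (product_topology (\<lambda>_. discrete_topology (alphabet \<theta>)) (lattice \<theta>))
        (discrete_topology (alphabet \<theta>)) (\<lambda>x. x (int_mat_inv A *\<^sub>v n))"
      by (rule continuous_map_product_projection)
    then have "continuous_map (subshift_topology \<theta>) (discrete_topology (alphabet \<theta>))
        (\<lambda>x. x (int_mat_inv A *\<^sub>v n))"
      unfolding subshift_topology_def by (rule continuous_map_from_subtopology)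
    moreover have "continuous_map (discrete_topology (alphabet \<theta>)) (discrete_topology (alphabet \<theta>)) \<tau>"
      using \<tau> by (simp add: permutes_in_image)
    ultimately show "continuous_map (subshift_topology \<theta>) (discrete_topology (alphabet \<theta>))
        (\<tau> \<circ> (\<lambda>x. x (int_mat_inv A *\<^sub>v n)))"
      by (rule continuous_map_compose)
    show "(\<tau> \<circ> (\<lambda>x. x (int_mat_inv A *\<^sub>v n))) x = induced_symmetry \<theta> \<tau> A x n"
      if "x \<in> topspace (subshift_topology \<theta>)" for x
      using that n by (simp add: induced_symmetry_apply)
  qed
  moreover have "induced_symmetry \<theta> \<tau> A x \<in> extensional (lattice \<theta>)" if "x \<in> subshift \<theta>" for x
    using mem[OF that] by (simp add: mem_subshift_iff PiE_def)
  ultimately have "continuous_map (subshift_topology \<theta>)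
      (product_topology (\<lambda>_. discrete_topology (alphabet \<theta>)) (lattice \<theta>)) (induced_symmetry \<theta> \<tau> A)"
    by (auto simp: continuous_map_componentwise)
  then show ?thesis
    using mem unfolding subshift_topology_def[of \<theta>] continuous_map_in_subtopology
    by (auto simp: subshift_topology_def[symmetric])
qed

lemma induced_symmetry_extended_symmetry:
  assumes \<theta>: "block_substitution \<theta>" and prim: "primitive \<theta>" and ss: "supertile_shuffling \<theta> \<tau> A"
  shows "extended_symmetry \<theta> (induced_symmetry \<theta> \<tau> A)"
proof -
  have GL: "A \<in> GL_int (rdim \<theta>)" and \<tau>: "\<tau> permutes alphabet \<theta>"
    using ss by (auto simp: supertile_shuffling_def)
  have A: "A \<in> carrier_mat (rdim \<theta>) (rdim \<theta>)" using GL by (simp add: GL_int_def)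
  note M = GL_int_inverse[OF GL]
  note ss' = supertile_shuffling_inverse[OF ss]
  let ?\<Phi> = "induced_symmetry \<theta> \<tau> A" and ?\<Psi> = "induced_symmetry \<theta> (inv_into UNIV \<tau>) (int_mat_inv A)"
  have "?\<Phi> (?\<Psi> x) = x" if "x \<in> subshift \<theta>" for x
    using induced_symmetry_inverse[OF \<theta> prim ss' that] permutes_inv_inv[OF \<tau>] M(5) by simp
  then have "homeomorphic_maps (subshift_topology \<theta>) (subshift_topology \<theta>) ?\<Phi> ?\<Psi>"
    using induced_symmetry_continuous[OF \<theta> prim] ss ss' induced_symmetry_inverse[OF \<theta> prim ss]
    by (simp add: homeomorphic_maps_def)
  then have "homeomorphic_map (subshift_topology \<theta>) (subshift_topology \<theta>) ?\<Phi>"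
    by (rule homeomorphic_maps_imp_map)
  moreover have "?\<Phi> (shift \<theta> n x) = shift \<theta> (A *\<^sub>v n) (?\<Phi> x)" if n: "n \<in> lattice \<theta>" and x: "x \<in> subshift \<theta>" for n x
  proof
    fix i
    show "?\<Phi> (shift \<theta> n x) i = shift \<theta> (A *\<^sub>v n) (?\<Phi> x) i"
    proof (cases "i \<in> lattice \<theta>")
      case True
      have An: "A *\<^sub>v n \<in> lattice \<theta>" and Mi: "int_mat_inv A *\<^sub>v i \<in> lattice \<theta>" using A M(2) n True by simp_all
      then have iAn: "i + A *\<^sub>v n \<in> lattice \<theta>" using True by simp
      have "int_mat_inv A *\<^sub>v (i + A *\<^sub>v n) = int_mat_inv A *\<^sub>v i + int_mat_inv A *\<^sub>v (A *\<^sub>v n)"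
        by (rule mult_add_distrib_mat_vec[OF M(2) True An])
      also have "int_mat_inv A *\<^sub>v (A *\<^sub>v n) = n"
        using assoc_mult_mat_vec[OF M(2) A n] M(4) n by simp
      finally show ?thesis
        using induced_symmetry_apply[OF shift_mem_subshift[OF x n] True] induced_symmetry_apply[OF x iAn] True Mi
        by (simp add: shift_def)
    next
      case False
      then show ?thesis using shift_mem_subshift[OF x n] by (simp add: induced_symmetry_def shift_def)
    qed
  qed
  ultimately show ?thesis
    unfolding extended_symmetry_def using GL by (auto simp: induced_symmetry_def)
qed

lemma image_shuffling_pairs:
  assumes "block_substitution \<theta>" "primitive \<theta>"
  shows "(\<lambda>(\<tau>, A). induced_symmetry \<theta> \<tau> A) ` {(\<tau>, A). supertile_shuffling \<theta> \<tau> A} = shuffling_symmetries \<theta>"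
  using induced_symmetry_extended_symmetry[OF assms]
  by (force simp: shuffling_symmetries_def extended_symmetry_group_def)

section \<open>The algorithm\<close>

text \<open>
  The positions of the unit box in the lexicographic order in which the code of a substitution lists them.
\<close>

definition positions :: "nat list \<Rightarrow> nat list list" where
  "positions L = product_lists (map (\<lambda>l. [0..<l]) L)"

text \<open>
  On \<^const>\<open>positions\<close>, with \<open>p\<close> respecting the side lengths, the subtraction of naturals does not truncate.
\<close>

definition reposition_list :: "nat list \<Rightarrow> (nat \<times> bool) list \<Rightarrow> nat list \<Rightarrow> nat list" where
  "reposition_list L p j = map
     (\<lambda>r. if snd (nth_default (0, False) p r) then nth_default 0 j (fst (nth_default (0, False) p r))
          else nth_default 0 L r - 1 - nth_default 0 j (fst (nth_default (0, False) p r)))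
     [0..<length L]"

definition lookup :: "nat list list \<Rightarrow> nat \<Rightarrow> nat \<Rightarrow> nat" where
  "lookup T a i = nth_default 0 (nth_default [] T a) i"

text \<open>
  The table \<open>snd x\<close> is indexed by numbers of positions. So the moved position is found by a search for the
  indices \<open>k\<close> at which it is listed.
\<close>

definition pair_step_list ::
    "nat list \<times> nat list list \<Rightarrow> (nat \<times> bool) list \<Rightarrow> (nat \<times> nat) list \<Rightarrow> (nat \<times> nat) list" where
  "pair_step_list x p R = concat (map (\<lambda>q. concat (map (\<lambda>i.
       map (\<lambda>k. (lookup (snd x) (fst q) k, lookup (snd x) (snd q) i))
         (filter (\<lambda>k. nth_default [] (positions (fst x)) k
              = reposition_list (fst x) p (nth_default [] (positions (fst x)) i))
            [0..<length (positions (fst x))]))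
       [0..<length (positions (fst x))])) R)"

definition window_size :: "nat list \<times> nat list list \<Rightarrow> nat" where
  "window_size x = 2 ^ (length (snd x) * length (snd x))"

text \<open>
  The argument \<open>x\<close> consists of the side lengths and the table of the substitution. In \<open>y\<close>, a permutation of
  the letters is given by its list of values, and a signed permutation of the axes by the list of the
  pairs \<open>(\<pi> r, s r)\<close>. For the candidates below, each list is as long as the range of its values, so
  surjectivity suffices for bijectivity.
\<close>

definition accepted :: "nat list \<times> nat list list \<Rightarrow> nat list \<times> (nat \<times> bool) list \<Rightarrow> bool" where
  "accepted x y \<longleftrightarrow>
     (\<forall>b \<in> set [0..<length (snd x)]. \<exists>c \<in> set (fst y). c = b) \<and>
     (\<forall>r \<in> set [0..<length (fst x)]. \<exists>q \<in> set (snd y). fst q = r) \<and>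
     map (\<lambda>q. nth_default 0 (fst x) (fst q)) (snd y) = fst x \<and>
     (\<forall>i \<in> set [0..<Suc (window_size x)].
       \<forall>q \<in> set ((pair_step_list x (snd y) ^^ (window_size x + i))
                    (map (\<lambda>a. (nth_default 0 (fst y) a, a)) [0..<length (snd x)])).
         fst q = nth_default 0 (fst y) (snd q))"

definition candidates :: "nat list \<times> nat list list \<Rightarrow> (nat list \<times> (nat \<times> bool) list) list" where
  "candidates x = List.product
     (product_lists (map (\<lambda>_. [0..<length (snd x)]) (snd x)))
     (product_lists (map (\<lambda>_. List.product [0..<length (fst x)] [True, False]) (fst x)))"

definition matrix_rows :: "(nat \<times> bool) list \<Rightarrow> int list list" where
  "matrix_rows p = map (\<lambda>q. map (\<lambda>c. if c = fst q then if snd q then 1 else -1 else 0) [0..<length p]) p"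

definition shuffling_pairs :: "nat list \<times> nat list list \<Rightarrow> (nat list \<times> int list list) list" where
  "shuffling_pairs x = map (\<lambda>y. (fst y, matrix_rows (snd y))) (filter (accepted x) (candidates x))"

lemma computable_positions:
  assumes "computable L"
  shows "computable (\<lambda>x. positions (L x))"
proof (rule computable_compose[OF _ assms])
  show "computable positions"
    unfolding positions_def [abs_def]
    by (intro computable_intros)
qed

lemma computable_reposition_list:
  assumes "computable L" "computable p" "computable j"
  shows "computable (\<lambda>x. reposition_list (L x) (p x) (j x))"
proof (rule computable_compose3[OF _ assms])
  show "computable (\<lambda>p. reposition_list (fst p) (fst (snd p)) (snd (snd p)))"
    unfolding reposition_list_def [abs_def]
    by (intro computable_intros)
qed

lemma computable_lookup:
  assumes "computable T" "computable a" "computable i"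
  shows "computable (\<lambda>x. lookup (T x) (a x) (i x))"
proof (rule computable_compose3[OF _ assms])
  show "computable (\<lambda>p. lookup (fst p) (fst (snd p)) (snd (snd p)))"
    unfolding lookup_def [abs_def]
    by (intro computable_intros)
qed

lemma computable_pair_step_list:
  assumes "computable f" "computable p" "computable R"
  shows "computable (\<lambda>x. pair_step_list (f x) (p x) (R x))"
proof (rule computable_compose3[OF _ assms])
  show "computable (\<lambda>p. pair_step_list (fst p) (fst (snd p)) (snd (snd p)))"
    unfolding pair_step_list_def [abs_def]
    by (intro computable_intros computable_positions computable_reposition_list computable_lookup)
qed

lemma computable_window_size:
  assumes "computable f"
  shows "computable (\<lambda>x. window_size (f x))"
proof (rule computable_compose[OF _ assms])
  show "computable window_size"
    unfolding window_size_def [abs_def]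
    by (intro computable_intros)
qed

lemma computable_accepted:
  assumes "computable f" "computable y"
  shows "computable (\<lambda>x. accepted (f x) (y x))"
proof (rule computable_compose2[OF _ assms])
  show "computable (\<lambda>p. accepted (fst p) (snd p))"
    unfolding accepted_def [abs_def]
    by (intro computable_intros computable_pair_step_list computable_window_size)
qed

lemma computable_shuffling_pairs: "computable shuffling_pairs"
  unfolding shuffling_pairs_def [abs_def] candidates_def matrix_rows_def
  by (intro computable_intros computable_accepted)

abbreviation axis :: "(nat \<times> bool) list \<Rightarrow> nat \<Rightarrow> nat" where
  "axis p \<equiv> \<lambda>r. fst (p ! r)"

abbreviation keeps :: "(nat \<times> bool) list \<Rightarrow> nat \<Rightarrow> bool" where
  "keeps p \<equiv> \<lambda>r. snd (p ! r)"

definition letter_map :: "nat list \<Rightarrow> nat \<Rightarrow> nat" where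
  "letter_map t a = (if a < length t then t ! a else a)"

lemma mem_product_lists_map_iff:
  "ys \<in> set (product_lists (map f xs)) \<longleftrightarrow>
     length ys = length xs \<and> (\<forall>i<length xs. ys ! i \<in> set (f (xs ! i)))"
  by (auto simp: product_lists_set list_all2_conv_all_nth)

lemma letter_map_permutes_iff:
  assumes t: "set t \<subseteq> {..<length t}"
  shows "letter_map t permutes {..<length t} \<longleftrightarrow> {..<length t} \<subseteq> set t"
proof -
  have img: "letter_map t ` {..<length t} = set t"
    by (force simp: letter_map_def in_set_conv_nth)
  show ?thesis
  proof
    assume "letter_map t permutes {..<length t}"
    then show "{..<length t} \<subseteq> set t" using img permutes_image by blast
  next
    assume "{..<length t} \<subseteq> set t"
    then have eq: "letter_map t ` {..<length t} = {..<length t}" using t img by blast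
    then have "inj_on (letter_map t) {..<length t}" by (intro eq_card_imp_inj_on) simp_all
    with eq show "letter_map t permutes {..<length t}"
      by (intro bij_imp_permutes) (auto simp: bij_betw_def letter_map_def)
  qed
qed

lemma mem_positions_iff:
  "j \<in> set (positions L) \<longleftrightarrow> length j = length L \<and> (\<forall>r<length L. j ! r < L ! r)"
  by (simp add: positions_def mem_product_lists_map_iff)

lemma positions_supp: "(\<lambda>j. vec_of_list (map int j)) ` set (positions (sides \<theta>)) = supp \<theta> 1"
proof (intro equalityI subsetI)
  fix v assume "v \<in> (\<lambda>j. vec_of_list (map int j)) ` set (positions (sides \<theta>))"
  then obtain j where v: "v = vec_of_list (map int j)" and "j \<in> set (positions (sides \<theta>))"
    by (rule imageE)
  then have j: "length j = rdim \<theta>" "\<forall>r<rdim \<theta>. j ! r < sides \<theta> ! r"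
    by (simp_all add: mem_positions_iff)
  show "v \<in> supp \<theta> 1"
    unfolding mem_supp_iff
  proof (intro conjI allI impI)
    show "v \<in> lattice \<theta>" unfolding v carrier_vec_def using j by (simp del: vec_of_list_map)
    fix r assume r: "r < rdim \<theta>"
    have i: "v $ r = int (j ! r)" unfolding v vec_of_list_index using r j(1) by simp
    show "0 \<le> v $ r" "v $ r < int (sides \<theta> ! r) ^ 1" unfolding i using j(2) r by simp_all
  qed
next
  fix v assume v: "v \<in> supp \<theta> 1"
  define j where "j = map (\<lambda>r. nat (v $ r)) [0..<rdim \<theta>]"
  have "j \<in> set (positions (sides \<theta>))"
    using v by (simp add: mem_positions_iff j_def mem_supp_iff nat_less_iff)
  moreover have "v = vec_of_list (map int j)"
    by (rule eq_vecI)
      (use v in \<open>simp_all add: j_def mem_supp_iff vec_of_list_index del: vec_of_list_map\<close>)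
  ultimately show "v \<in> (\<lambda>j. vec_of_list (map int j)) ` set (positions (sides \<theta>))" by blast
qed

context
  fixes \<theta> :: "nat block_subst" and m d :: nat and T :: "nat list list"
  assumes \<theta>: "block_substitution \<theta>" and alphabet: "alphabet \<theta> = {..<m}"
  defines "T \<equiv> map (\<lambda>a. map (\<lambda>j. rule \<theta> a (vec_of_list (map int j))) (positions (sides \<theta>))) [0..<m]"
    and "d \<equiv> rdim \<theta>"
begin

lemma length_T [simp]: "length T = m"
  by (simp add: T_def)

lemma encode_subst_eq: "encode_subst \<theta> = encode (sides \<theta>, T)"
proof -
  have nats: "encode xs = list_encode xs" for xs :: "nat list" by (simp add: encode_list_def map_idI)
  have "encode (sides \<theta>, T) = prod_encode (list_encode (sides \<theta>), list_encode (map list_encode T))"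
    by (simp add: encode_list_def[of T] nats cong: map_cong)
  then show ?thesis by (simp add: encode_subst_def T_def alphabet positions_def comp_def)
qed

lemma lookup_eq:
  "a < m \<Longrightarrow> i < length (positions (sides \<theta>)) \<Longrightarrow>
    lookup T a i = rule \<theta> a (vec_of_list (map int (positions (sides \<theta>) ! i)))"
  by (simp add: lookup_def T_def nth_default_nth)

context
  fixes p :: "(nat \<times> bool) list"
  assumes p_length: "length p = d" and p_less: "\<And>r. r < d \<Longrightarrow> fst (p ! r) < d"
begin

text \<open>
  The right-hand side is the test that the search performs.
\<close>

lemma side_perm_iff:
  "side_perm \<theta> (axis p) \<longleftrightarrow> (\<forall>r \<in> set [0..<d]. \<exists>q \<in> set p. fst q = r) \<and>
     map (\<lambda>q. nth_default 0 (sides \<theta>) (fst q)) p = sides \<theta>"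
proof -
  have img: "axis p ` {..<d} = fst ` set p" using p_length by (force simp: in_set_conv_nth)
  have "bij_betw (axis p) {..<d} {..<d} \<longleftrightarrow> {..<d} \<subseteq> fst ` set p"
  proof
    assume "{..<d} \<subseteq> fst ` set p"
    moreover have "axis p ` {..<d} \<subseteq> {..<d}" using p_less by auto
    ultimately have eq: "axis p ` {..<d} = {..<d}" unfolding img by (intro equalityI)
    then have "inj_on (axis p) {..<d}" by (intro eq_card_imp_inj_on) simp_all
    with eq show "bij_betw (axis p) {..<d} {..<d}" by (simp add: bij_betw_def)
  qed (use img in \<open>auto simp: bij_betw_def\<close>)
  moreover have "map (\<lambda>q. nth_default 0 (sides \<theta>) (fst q)) p = sides \<theta> \<longleftrightarrow>
      (\<forall>r<d. sides \<theta> ! fst (p ! r) = sides \<theta> ! r)"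
    using p_length p_less by (auto simp: list_eq_iff_nth_eq d_def nth_default_nth)
  moreover have "{..<d} \<subseteq> fst ` set p \<longleftrightarrow> (\<forall>r \<in> set [0..<d]. \<exists>q \<in> set p. fst q = r)"
    by (force simp: subset_iff image_iff)
  ultimately show ?thesis by (simp add: side_perm_def d_def[symmetric])
qed

lemma matrix_rows_eq:
  "mat_of_rows_list d (matrix_rows p) = signed_perm_mat d (axis p) (keeps p)"
  "mat_to_list (mat_of_rows_list d (matrix_rows p)) = matrix_rows p"
  using p_length
  by (auto simp: mat_of_rows_list_def matrix_rows_def signed_perm_mat_def mat_to_list_def
      intro!: eq_matI nth_equalityI)

context
  assumes sp: "side_perm \<theta> (axis p)"
begin

lemma position_axis:
  assumes "j \<in> set (positions (sides \<theta>))" "r < d"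
  shows "length j = d" "j ! axis p r < sides \<theta> ! r"
proof -
  have j: "length j = d" "\<And>i. i < d \<Longrightarrow> j ! i < sides \<theta> ! i"
    using assms(1) by (auto simp: positions_def mem_product_lists_map_iff d_def)
  show "length j = d" by (rule j)
  show "j ! axis p r < sides \<theta> ! r"
    using j(2)[of "axis p r"] p_less[OF assms(2)] side_permD(2)[OF sp, of r] assms(2) by (simp add: d_def)
qed

lemma reposition_list_eq:
  assumes j: "j \<in> set (positions (sides \<theta>))"
  shows "vec_of_list (map int (reposition_list (sides \<theta>) p j)) = reposition \<theta> (axis p) (keeps p) 1 (vec_of_list (map int j))"
proof (rule eq_vecI)
  fix r assume "r < dim_vec (reposition \<theta> (axis p) (keeps p) 1 (vec_of_list (map int j)))"
  then have r: "r < d" by (simp add: reposition_def d_def)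
  note len = position_axis[OF j r]
  show "vec_of_list (map int (reposition_list (sides \<theta>) p j)) $ r = reposition \<theta> (axis p) (keeps p) 1 (vec_of_list (map int j)) $ r"
    using r len p_length p_less[OF r]
    by (auto simp: reposition_list_def reposition_def d_def vec_of_list_index nth_default_nth of_nat_diff
        simp del: vec_of_list_map)
qed (simp add: reposition_list_def reposition_def)

lemma reposition_list_mem:
  assumes j: "j \<in> set (positions (sides \<theta>))"
  shows "reposition_list (sides \<theta>) p j \<in> set (positions (sides \<theta>))"
proof -
  have "0 < sides \<theta> ! r" if "r < rdim \<theta>" for r using sides_ge_2[OF \<theta> that] by simp
  then show ?thesis
    using position_axis[OF j] p_length p_less
    by (auto simp: reposition_list_def positions_def mem_product_lists_map_iff d_def nth_default_nth)
qed

lemma set_pair_step_list: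
  assumes R: "set R \<subseteq> {..<m} \<times> {..<m}"
  shows "set (pair_step_list (sides \<theta>, T) p R) = pair_step \<theta> (axis p) (keeps p) (set R)"
proof -
  let ?D = "positions (sides \<theta>)"
  let ?v = "\<lambda>j. vec_of_list (map int j)"
  have "set (pair_step_list (sides \<theta>, T) p R) = (\<Union>q \<in> set R. \<Union>i \<in> {..<length ?D}.
      (\<lambda>k. (lookup T (fst q) k, lookup T (snd q) i)) `
        {k. k < length ?D \<and> nth_default [] ?D k = reposition_list (sides \<theta>) p (nth_default [] ?D i)})"
    by (simp add: pair_step_list_def atLeast0LessThan)
  also have "\<dots> = (\<Union>q \<in> set R. \<Union>i \<in> {..<length ?D}.
      {(rule \<theta> (fst q) (reposition \<theta> (axis p) (keeps p) 1 (?v (?D ! i))), rule \<theta> (snd q) (?v (?D ! i)))})"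
  proof (intro SUP_cong refl)
    fix q i assume q: "q \<in> set R" and i: "i \<in> {..<length ?D}"
    have q': "fst q < m" "snd q < m" using subsetD[OF R q] by auto
    have j: "?D ! i \<in> set ?D" using i by simp
    define K where
      "K = {k. k < length ?D \<and> nth_default [] ?D k = reposition_list (sides \<theta>) p (nth_default [] ?D i)}"
    have K: "k < length ?D \<and> ?D ! k = reposition_list (sides \<theta>) p (?D ! i)" if "k \<in> K" for k
      using that i unfolding K_def mem_Collect_eq by (metis lessThan_iff nth_default_nth)
    have fst_eq: "lookup T (fst q) k = rule \<theta> (fst q) (reposition \<theta> (axis p) (keeps p) 1 (?v (?D ! i)))"
      if "k \<in> K" for k
      unfolding lookup_eq[OF q'(1) conjunct1[OF K[OF that]]] conjunct2[OF K[OF that]]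
        reposition_list_eq[OF j] ..
    have snd_eq: "lookup T (snd q) i = rule \<theta> (snd q) (?v (?D ! i))"
      by (rule lookup_eq[OF q'(2)]) (use i in simp)
    obtain k0 where "k0 < length ?D" "?D ! k0 = reposition_list (sides \<theta>) p (?D ! i)"
      using reposition_list_mem[OF j] unfolding in_set_conv_nth by blast
    then have k0: "k0 \<in> K"
      using i unfolding K_def mem_Collect_eq by (metis lessThan_iff nth_default_nth)
    have "(\<lambda>k. (lookup T (fst q) k, lookup T (snd q) i)) ` K = (\<lambda>k.
        (rule \<theta> (fst q) (reposition \<theta> (axis p) (keeps p) 1 (?v (?D ! i))), rule \<theta> (snd q) (?v (?D ! i)))) ` K"
      by (rule image_cong) (simp_all only: fst_eq snd_eq)
    also have "\<dots> =
        {(rule \<theta> (fst q) (reposition \<theta> (axis p) (keeps p) 1 (?v (?D ! i))), rule \<theta> (snd q) (?v (?D ! i)))}"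
      by (rule image_constant[OF k0])
    finally show "(\<lambda>k. (lookup T (fst q) k, lookup T (snd q) i)) `
        {k. k < length ?D \<and> nth_default [] ?D k = reposition_list (sides \<theta>) p (nth_default [] ?D i)} =
        {(rule \<theta> (fst q) (reposition \<theta> (axis p) (keeps p) 1 (?v (?D ! i))), rule \<theta> (snd q) (?v (?D ! i)))}"
      by (simp only: K_def)
  qed
  also have "\<dots> = pair_step \<theta> (axis p) (keeps p) (set R)"
  proof -
    have "set ?D = (!) ?D ` {..<length ?D}" by (auto simp: set_conv_nth)
    then have "supp \<theta> 1 = (\<lambda>i. ?v (?D ! i)) ` {..<length ?D}"
      unfolding positions_supp[symmetric] by (simp only: image_image)
    then show ?thesis unfolding pair_step_eq_UN by (simp only: image_image)
  qed
  finally show ?thesis .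
qed

lemma set_pair_step_list_iterate:
  assumes t: "length t = m" and \<tau>: "letter_map t permutes {..<m}"
  shows "set ((pair_step_list (sides \<theta>, T) p ^^ n) (map (\<lambda>a. (nth_default 0 t a, a)) [0..<m]))
    = letter_pairs \<theta> (letter_map t) (axis p) (keeps p) n"
proof (induction n)
  case 0
  have "(\<lambda>a. (nth_default 0 t a, a)) ` {..<m} = (\<lambda>a. (letter_map t a, a)) ` {..<m}"
    by (rule image_cong) (simp_all add: letter_map_def nth_default_nth t)
  then show ?case by (simp add: letter_pairs_0 alphabet atLeast0LessThan)
next
  case (Suc n)
  have "column \<theta> n j a < m" if "a < m" for j a
    using column_mem_alphabet[OF \<theta>, of a] that by (simp add: alphabet)
  moreover have "letter_map t a < m" if "a < m" for a
    using permutes_in_image[OF \<tau>, of a] that by simp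
  ultimately have "letter_pairs \<theta> (letter_map t) (axis p) (keeps p) n \<subseteq> {..<m} \<times> {..<m}"
    by (auto simp: letter_pairs_def alphabet)
  then have "set (pair_step_list (sides \<theta>, T) p ((pair_step_list (sides \<theta>, T) p ^^ n)
      (map (\<lambda>a. (nth_default 0 t a, a)) [0..<m]))) = pair_step \<theta> (axis p) (keeps p) (letter_pairs \<theta> (letter_map t) (axis p) (keeps p) n)"
    unfolding Suc.IH[symmetric] by (rule set_pair_step_list)
  then show ?case by (simp only: funpow.simps comp_apply letter_pairs_Suc[OF \<theta> sp])
qed

end

lemma accepted_iff:
  assumes t: "length t = m" "set t \<subseteq> {..<m}"
  shows "accepted (sides \<theta>, T) (t, p) \<longleftrightarrow> letter_map t permutes {..<m} \<and> side_perm \<theta> (axis p) \<and>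
    (\<exists>N. \<forall>n\<ge>N. columns_commute \<theta> (letter_map t) (axis p) (keeps p) n)"
proof -
  let ?B = "window_size (sides \<theta>, T)"
  let ?R = "\<lambda>n. (pair_step_list (sides \<theta>, T) p ^^ n) (map (\<lambda>a. (nth_default 0 t a, a)) [0..<m])"
  have perm: "letter_map t permutes {..<m} \<longleftrightarrow> (\<forall>b \<in> set [0..<m]. \<exists>c \<in> set t. c = b)"
    using letter_map_permutes_iff[of t] t by auto
  have window: "(\<forall>i \<in> set [0..<Suc ?B]. \<forall>q \<in> set (?R (?B + i)). fst q = nth_default 0 t (snd q)) \<longleftrightarrow>
      (\<exists>N. \<forall>n\<ge>N. columns_commute \<theta> (letter_map t) (axis p) (keeps p) n)"
    if \<tau>: "letter_map t permutes {..<m}" and sp: "side_perm \<theta> (axis p)"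
  proof -
    have pairs: "set (?R n) = letter_pairs \<theta> (letter_map t) (axis p) (keeps p) n" for n
      by (rule set_pair_step_list_iterate[OF sp t(1) \<tau>])
    have "snd q < m" if "q \<in> letter_pairs \<theta> (letter_map t) (axis p) (keeps p) n" for q n
      using that column_mem_alphabet[OF \<theta>] alphabet by (force simp: letter_pairs_def)
    then have comm: "(\<forall>q \<in> set (?R n). fst q = nth_default 0 t (snd q)) \<longleftrightarrow>
        columns_commute \<theta> (letter_map t) (axis p) (keeps p) n" for n
      unfolding pairs columns_commute_iff_pairs using t(1)
      by (intro ball_cong refl) (simp add: nth_default_nth letter_map_def)
    have B: "?B = 2 ^ (card (alphabet \<theta>) * card (alphabet \<theta>))"
      by (simp add: window_size_def alphabet)
    have "(\<forall>i \<in> set [0..<Suc ?B]. columns_commute \<theta> (letter_map t) (axis p) (keeps p) (?B + i)) \<longleftrightarrow>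
        (\<forall>n \<in> {?B..2 * ?B}. columns_commute \<theta> (letter_map t) (axis p) (keeps p) n)"
    proof -
      have "{?B..2 * ?B} = (\<lambda>i. ?B + i) ` set [0..<Suc ?B]"
        by (simp add: image_add_atLeastLessThan' atLeastLessThanSuc_atLeastAtMost del: upt_Suc)
      then show ?thesis by (simp only: ball_simps)
    qed
    moreover have "letter_map t permutes alphabet \<theta>" using \<tau> by (simp add: alphabet)
    ultimately show ?thesis
      unfolding comm using eventually_commuting_iff[OF \<theta> sp, of "letter_map t" "keeps p"]
      unfolding B by blast
  qed
  show ?thesis
    unfolding accepted_def fst_conv snd_conv length_T
    using perm side_perm_iff window by (simp only: d_def) blast
qed

end

lemma mem_candidates_iff:
  "(t, p) \<in> set (candidates (sides \<theta>, T)) \<longleftrightarrow>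
     length t = m \<and> set t \<subseteq> {..<m} \<and> length p = d \<and> (\<forall>r<d. fst (p ! r) < d)"
proof -
  have "set t \<subseteq> {..<m} \<longleftrightarrow> (\<forall>a<m. t ! a < m)" if "length t = m"
    using that by (auto simp: subset_iff in_set_conv_nth)
  moreover have "b = True \<or> b = False" for b by simp
  ultimately show ?thesis
    by (auto simp: candidates_def mem_product_lists_map_iff d_def mem_Times_iff)
qed

definition decode_pair :: "nat list \<times> (nat \<times> bool) list \<Rightarrow> (nat \<Rightarrow> nat) \<times> int mat" where
  "decode_pair y = (letter_map (fst y), mat_of_rows_list d (matrix_rows (snd y)))"

text \<open>
  Hence the output of the search is literally the code of the list of decoded pairs.
\<close>

lemma encode_pair_decode_pair:
  assumes "y \<in> set (candidates (sides \<theta>, T))"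
  shows "encode_pair \<theta> (decode_pair y) = encode (fst y, matrix_rows (snd y))"
proof -
  obtain t p where y: "y = (t, p)" by (cases y)
  have t: "length t = m" and p: "length p = d" "\<And>r. r < d \<Longrightarrow> fst (p ! r) < d"
    using assms unfolding y mem_candidates_iff by auto
  have "map (letter_map t) [0..<m] = t"
    using t by (intro nth_equalityI) (auto simp: letter_map_def)
  moreover have "encode t = list_encode t" by (simp add: encode_list_def map_idI)
  moreover have rows: "encode = (\<lambda>row :: int list. list_encode (map int_encode row))"
    by (rule ext) (simp add: encode_list_def)
  have "encode M = list_encode (map (\<lambda>row. list_encode (map int_encode row)) M)" for M :: "int list list"
    unfolding encode_list_def[of M] rows ..
  ultimately show ?thesis
    using matrix_rows_eq(2)[OF p] by (simp add: y encode_pair_def decode_pair_def alphabet)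
qed

lemma decode_pair_accepted:
  "decode_pair ` {y \<in> set (candidates (sides \<theta>, T)). accepted (sides \<theta>, T) y} = {(\<tau>, A). supertile_shuffling \<theta> \<tau> A}"
proof (intro equalityI subsetI)
  fix z assume "z \<in> decode_pair ` {y \<in> set (candidates (sides \<theta>, T)). accepted (sides \<theta>, T) y}"
  then obtain t p where z: "z = decode_pair (t, p)" and c: "(t, p) \<in> set (candidates (sides \<theta>, T))"
    and a: "accepted (sides \<theta>, T) (t, p)" by auto
  have t: "length t = m" "set t \<subseteq> {..<m}" and p: "length p = d" "\<And>r. r < d \<Longrightarrow> fst (p ! r) < d"
    using c unfolding mem_candidates_iff by auto
  have "letter_map t permutes alphabet \<theta>" "side_perm \<theta> (axis p)"
    "\<exists>N. \<forall>n\<ge>N. columns_commute \<theta> (letter_map t) (axis p) (keeps p) n"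
    using iffD1[OF accepted_iff[OF p t] a] by (simp_all add: alphabet)
  moreover have "mat_of_rows_list d (matrix_rows p) = signed_perm_mat (rdim \<theta>) (axis p) (keeps p)"
    using matrix_rows_eq(1)[OF p] by (simp only: d_def)
  ultimately have "supertile_shuffling \<theta> (letter_map t) (mat_of_rows_list d (matrix_rows p))"
    unfolding supertile_shuffling_iff[OF \<theta>] by iprover
  then show "z \<in> {(\<tau>, A). supertile_shuffling \<theta> \<tau> A}" by (simp add: z decode_pair_def)
next
  fix z assume "z \<in> {(\<tau>, A). supertile_shuffling \<theta> \<tau> A}"
  then obtain \<tau> A where z: "z = (\<tau>, A)" and "supertile_shuffling \<theta> \<tau> A" by (cases z) simp
  then have "\<tau> permutes alphabet \<theta> \<and> (\<exists>\<pi> s. side_perm \<theta> \<pi> \<and> A = signed_perm_mat (rdim \<theta>) \<pi> s \<and>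
      (\<exists>N. \<forall>n\<ge>N. columns_commute \<theta> \<tau> \<pi> s n))"
    by (simp only: supertile_shuffling_iff[OF \<theta>])
  then have \<tau>: "\<tau> permutes {..<m}" and "\<exists>\<pi> s. side_perm \<theta> \<pi> \<and> A = signed_perm_mat d \<pi> s \<and>
      (\<exists>N. \<forall>n\<ge>N. columns_commute \<theta> \<tau> \<pi> s n)"
    by (simp_all only: alphabet d_def)
  then obtain \<pi> s where "side_perm \<theta> \<pi> \<and> A = signed_perm_mat d \<pi> s \<and>
      (\<exists>N. \<forall>n\<ge>N. columns_commute \<theta> \<tau> \<pi> s n)"
    by (elim exE)
  then have sp: "side_perm \<theta> \<pi>" and A: "A = signed_perm_mat d \<pi> s"
    and ev: "\<exists>N. \<forall>n\<ge>N. columns_commute \<theta> \<tau> \<pi> s n"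
    by simp_all
  define t where "t = map \<tau> [0..<m]"
  define p where "p = map (\<lambda>r. (\<pi> r, s r)) [0..<d]"
  have t: "length t = m" "set t \<subseteq> {..<m}"
    using permutes_image[OF \<tau>] by (simp_all add: t_def atLeast0LessThan)
  have p_length: "length p = d" by (simp add: p_def)
  have p_less: "fst (p ! r) < d" if "r < d" for r
  proof -
    have "fst (p ! r) = \<pi> r" using that by (simp add: p_def)
    then show "fst (p ! r) < d" using side_permD(1)[OF sp, of r] that by (simp add: d_def)
  qed
  have \<tau>_eq: "letter_map t = \<tau>"
    using permutes_not_in[OF \<tau>] by (auto simp: letter_map_def t_def)
  have rep: "reposition \<theta> (axis p) (keeps p) n j = reposition \<theta> \<pi> s n j" for n j
    by (rule eq_vecI) (auto simp: reposition_def p_def d_def)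
  have "bij_betw (axis p) {..<rdim \<theta>} {..<rdim \<theta>} \<longleftrightarrow> bij_betw \<pi> {..<rdim \<theta>} {..<rdim \<theta>}"
    by (rule bij_betw_cong) (simp add: p_def d_def)
  then have "side_perm \<theta> (axis p)" using sp by (simp add: side_perm_def p_def d_def)
  then have "accepted (sides \<theta>, T) (t, p)"
    using accepted_iff[OF p_length p_less t] \<tau> ev by (simp add: \<tau>_eq columns_commute_def rep)
  moreover have "(t, p) \<in> set (candidates (sides \<theta>, T))" using t p_length p_less by (simp add: mem_candidates_iff)
  moreover have "signed_perm_mat d (axis p) (keeps p) = A"
    unfolding A by (rule eq_matI) (auto simp: signed_perm_mat_def p_def)
  then have "decode_pair (t, p) = z" by (simp add: decode_pair_def \<tau>_eq z matrix_rows_eq(1)[OF p_length p_less])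
  ultimately show "z \<in> decode_pair ` {y \<in> set (candidates (sides \<theta>, T)). accepted (sides \<theta>, T) y}" by blast
qed

lemma shuffling_pairs_correct:
  obtains out where "list_encode (map (encode_pair \<theta>) out) = encode (shuffling_pairs (sides \<theta>, T))"
    "set out = {(\<tau>, A). supertile_shuffling \<theta> \<tau> A}"
proof
  let ?ys = "filter (accepted (sides \<theta>, T)) (candidates (sides \<theta>, T))"
  show "set (map decode_pair ?ys) = {(\<tau>, A). supertile_shuffling \<theta> \<tau> A}"
    using decode_pair_accepted by simp
  have "map (encode_pair \<theta>) (map decode_pair ?ys) = map encode (shuffling_pairs (sides \<theta>, T))"
    by (simp add: shuffling_pairs_def encode_pair_decode_pair del: encode_prod_def)
  then show "list_encode (map (encode_pair \<theta>) (map decode_pair ?ys)) = encode (shuffling_pairs (sides \<theta>, T))"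
    by (simp only: encode_list_def)
qed

end

theorem theorem1:
  shows "\<exists>e :: recf. \<forall>\<theta> :: nat block_subst.
    block_substitution \<theta> \<and> alphabet \<theta> = {..<card (alphabet \<theta>)} \<and>
    primitive \<theta> \<and> aperiodic \<theta> \<and>
    1 < column_number \<theta> \<and> column_number \<theta> < card (alphabet \<theta>) \<longrightarrow>
    (\<exists>out :: ((nat \<Rightarrow> nat) \<times> int mat) list.
       computes e [encode_subst \<theta>] (list_encode (map (encode_pair \<theta>) out)) \<and>
       set out = {(\<tau>, A). supertile_shuffling \<theta> \<tau> A} \<and>
       (\<lambda>(\<tau>, A). induced_symmetry \<theta> \<tau> A) ` set out = shuffling_symmetries \<theta>)"
proof -
  obtain e where e: "\<forall>x. computes e [encode x] (encode (shuffling_pairs x))"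
    using computable_shuffling_pairs unfolding computable_def by (rule exE)
  show ?thesis
  proof (intro exI[of _ e] allI impI, elim conjE)
    fix \<theta> :: "nat block_subst"
    assume \<theta>: "block_substitution \<theta>" and alphabet: "alphabet \<theta> = {..<card (alphabet \<theta>)}"
      and prim: "primitive \<theta>"
    obtain out where "list_encode (map (encode_pair \<theta>) out) = encode (shuffling_pairs (sides \<theta>,
        map (\<lambda>a. map (\<lambda>j. rule \<theta> a (vec_of_list (map int j))) (positions (sides \<theta>))) [0..<card (alphabet \<theta>)]))"
      and out: "set out = {(\<tau>, A). supertile_shuffling \<theta> \<tau> A}"
      by (rule shuffling_pairs_correct[OF \<theta> alphabet])
    then have "computes e [encode_subst \<theta>] (list_encode (map (encode_pair \<theta>) out))"
      unfolding encode_subst_eq[OF \<theta> alphabet] using spec[OF e] by (simp only:)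
    moreover have "(\<lambda>(\<tau>, A). induced_symmetry \<theta> \<tau> A) ` set out = shuffling_symmetries \<theta>"
      unfolding out by (rule image_shuffling_pairs[OF \<theta> prim])
    ultimately show "\<exists>out. computes e [encode_subst \<theta>] (list_encode (map (encode_pair \<theta>) out)) \<and>
       set out = {(\<tau>, A). supertile_shuffling \<theta> \<tau> A} \<and>
       (\<lambda>(\<tau>, A). induced_symmetry \<theta> \<tau> A) ` set out = shuffling_symmetries \<theta>"
      using out by (intro exI[of _ out] conjI)
  qed
qed

end
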